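(* There exist absolute constants $c_1, c_2 > 0$ such that for every $n \ge 1$ and all $p_1,\dots,p_n \in [0,1]$ with $\lambda = p_1+\dots+p_n > 0$, setting $\lambda_2 = p_1^2+\dots+p_n^2$ and $$F = \frac{\max(1,\lambda)}{\max(1,\lambda-\lambda_2)},$$ one has $$c_1 \Big(\frac{\lambda_2}{\lambda}\Big)^2 (1+\log F) \le D(W||Z) \le c_2 \Big(\frac{\lambda_2}{\lambda}\Big)^2 (1+\log F)$$ and $$c_1 \Big(\frac{\lambda_2}{\lambda}\Big)^2 \sqrt{F} \le \chi^2(W,Z) \le c_2 \Big(\frac{\lambda_2}{\lambda}\Big)^2 \sqrt{F}.$$
   Context: $W = X_1+\dots+X_n$ is the sum of independent random variables $X_j$ taking the values $1$ and $0$ with probabilities $p_j$ and $q_j = 1-p_j$. $Z$ is a Poisson random variable with parameter $\lambda = p_1+\dots+p_n$. Write $w_k = \mathbb{P}\{W=k\}$ and $v_k = \mathbb{P}\{Z=k\} = \frac{\lambda^k}{k!}e^{-\lambda}$, $k = 0,1,2,\dots$. The relative entropy and the Pearson $\chi^2$-distance are $$D(W||Z) = \sum_{k=0}^\infty w_k \log\frac{w_k}{v_k}, \qquad \chi^2(W,Z) = \sum_{k=0}^\infty \frac{(w_k-v_k)^2}{v_k},$$ with natural logarithm and the convention $0\log 0 = 0$. *)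

theory Defs
  imports "HOL-Probability.Probability"
begin

text \<open>
  The law of \<open>W = X\<^sub>1 + \<dots> + X\<^sub>n\<close> is taken on the canonical product space. This avoids a type
  variable for the sample space, on which absolute constants would formally be allowed to depend.
  Lemma \<open>prob_sum_bernoulli\<close> below shows that it is the law of \<open>W\<close> on any probability space.
\<close>

definition bernoulli_sum_pmf :: "nat \<Rightarrow> (nat \<Rightarrow> real) \<Rightarrow> nat pmf" where
  "bernoulli_sum_pmf n p =
     map_pmf (\<lambda>x. \<Sum>j=1..n. of_bool (x j)) (Pi_pmf {1..n} False (\<lambda>j. bernoulli_pmf (p j)))"

text \<open>
  In the next definition \<open>0 * ln 0 = 0\<close> is built in. Both definitions are meant for \<open>Q\<close> with full
  support; in general a point outside the support of \<open>Q\<close> would wrongly contribute \<open>0\<close>.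
\<close>

definition rel_entropy :: "nat pmf \<Rightarrow> nat pmf \<Rightarrow> real" where
  "rel_entropy P Q = (\<Sum>k. pmf P k * ln (pmf P k / pmf Q k))"

definition chi_square_dist :: "nat pmf \<Rightarrow> nat pmf \<Rightarrow> real" where
  "chi_square_dist P Q = (\<Sum>k. (pmf P k - pmf Q k)\<^sup>2 / pmf Q k)"

lemma (in prob_space) prob_sum_bernoulli_subsets:
  fixes X :: "nat \<Rightarrow> 'a \<Rightarrow> real" and p :: "nat \<Rightarrow> real"
  assumes n: "n \<ge> 1"
    and ind: "indep_vars (\<lambda>_. borel) X {1..n}"
    and one: "\<And>j. j \<in> {1..n} \<Longrightarrow> prob {\<omega> \<in> space M. X j \<omega> = 1} = p j"
    and zero: "\<And>j. j \<in> {1..n} \<Longrightarrow> prob {\<omega> \<in> space M. X j \<omega> = 0} = 1 - p j"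
  shows "prob {\<omega> \<in> space M. (\<Sum>j=1..n. X j \<omega>) = real k} =
    (\<Sum>A | A \<subseteq> {1..n} \<and> card A = k. \<Prod>j=1..n. if j \<in> A then p j else 1 - p j)"
proof -
  define I where "I = {1..n}"
  define E where "E A = (\<Inter>j\<in>I. X j -` {of_bool (j \<in> A)} \<inter> space M)" for A
  define S where "S = {A. A \<subseteq> I \<and> card A = k}"
  have I: "finite I" "I \<noteq> {}" using n by (auto simp: I_def)
  have finS: "finite S" using I by (simp add: S_def)
  have rv: "X j \<in> borel_measurable M" if "j \<in> I" for j
    using ind that by (auto simp: indep_vars_def I_def)
  have EM: "E A \<in> events" for A
    unfolding E_def using I rv by (intro sets.finite_INT measurable_sets) auto
  have PE: "prob (E A) = (\<Prod>j\<in>I. if j \<in> A then p j else 1 - p j)" for A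
  proof -
    have "prob (E A) = (\<Prod>j\<in>I. prob (X j -` {of_bool (j \<in> A)} \<inter> space M))"
      unfolding E_def using I ind by (intro indep_varsD_finite) (auto simp: I_def)
    also have "\<dots> = (\<Prod>j\<in>I. if j \<in> A then p j else 1 - p j)"
    proof (rule prod.cong[OF refl])
      fix j assume j: "j \<in> I"
      have "X j -` {of_bool (j \<in> A)} \<inter> space M = {\<omega> \<in> space M. X j \<omega> = of_bool (j \<in> A)}" by auto
      then show "prob (X j -` {of_bool (j \<in> A)} \<inter> space M) = (if j \<in> A then p j else 1 - p j)"
        using one zero j by (simp add: I_def)
    qed
    finally show ?thesis .
  qed
  have disj: "disjoint_family_on E S"
  proof (unfold disjoint_family_on_def, intro ballI impI)
    fix A B assume A: "A \<in> S" and B: "B \<in> S" and ne: "A \<noteq> B"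
    then obtain j where j: "j \<in> I" "(j \<in> A) \<noteq> (j \<in> B)" unfolding S_def by blast
    show "E A \<inter> E B = {}"
    proof (rule ccontr)
      assume "E A \<inter> E B \<noteq> {}"
      then obtain \<omega> where "\<omega> \<in> E A" "\<omega> \<in> E B" by blast
      then have "X j \<omega> = of_bool (j \<in> A)" "X j \<omega> = of_bool (j \<in> B)"
        using j(1) unfolding E_def by blast+
      then show False using j(2) by (simp add: of_bool_eq_iff)
    qed
  qed
  have "AE \<omega> in M. X j \<omega> = 0 \<or> X j \<omega> = 1" if j: "j \<in> I" for j
  proof -
    have [measurable]: "X j \<in> borel_measurable M" using rv j .
    have "prob ({\<omega> \<in> space M. X j \<omega> = 0} \<union> {\<omega> \<in> space M. X j \<omega> = 1}) = (1 - p j) + p j"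
      using one zero j by (subst finite_measure_Union) (auto simp: I_def)
    moreover have "{\<omega> \<in> space M. X j \<omega> = 0} \<union> {\<omega> \<in> space M. X j \<omega> = 1} =
        {\<omega> \<in> space M. X j \<omega> = 0 \<or> X j \<omega> = 1}" by auto
    ultimately have "prob {\<omega> \<in> space M. X j \<omega> = 0 \<or> X j \<omega> = 1} = 1" by simp
    then show ?thesis by (subst (asm) prob_Collect_eq_1) auto
  qed
  then have ae: "AE \<omega> in M. \<forall>j\<in>I. X j \<omega> = 0 \<or> X j \<omega> = 1"
    using I by (simp add: AE_finite_all)
  have "prob {\<omega> \<in> space M. (\<Sum>j\<in>I. X j \<omega>) = real k} = prob (\<Union>A\<in>S. E A)"
  proof (rule finite_measure_eq_AE)
    show "AE \<omega> in M. \<omega> \<in> {\<omega> \<in> space M. (\<Sum>j\<in>I. X j \<omega>) = real k} \<longleftrightarrow> \<omega> \<in> (\<Union>A\<in>S. E A)"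
      using ae AE_space
    proof eventually_elim
      case (elim \<omega>)
      define B where "B = {j \<in> I. X j \<omega> = 1}"
      have X: "X j \<omega> = of_bool (j \<in> B)" if "j \<in> I" for j
        using elim that by (auto simp: B_def)
      have "(\<Sum>j\<in>I. X j \<omega>) = (\<Sum>j\<in>I. of_bool (j \<in> B))"
        using X by (intro sum.cong) auto
      also have "\<dots> = real (card B)"
        using I by (simp add: B_def Int_def conj_commute)
      finally have sum: "(\<Sum>j\<in>I. X j \<omega>) = real (card B)" .
      have "\<omega> \<in> E A \<longleftrightarrow> A = B" if "A \<subseteq> I" for A
      proof
        assume "\<omega> \<in> E A"
        then have "\<forall>j\<in>I. X j \<omega> = of_bool (j \<in> A)" unfolding E_def by blast
        then have "\<forall>j\<in>I. (j \<in> B) = (j \<in> A)" using X by (simp add: of_bool_eq_iff)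
        moreover have "B \<subseteq> I" by (auto simp: B_def)
        ultimately show "A = B" using that by blast
      qed (use X elim I in \<open>auto simp: E_def\<close>)
      then have "\<omega> \<in> (\<Union>A\<in>S. E A) \<longleftrightarrow> card B = k" by (auto simp: S_def B_def)
      then show ?case using elim sum by auto
    qed
    show "{\<omega> \<in> space M. (\<Sum>j\<in>I. X j \<omega>) = real k} \<in> events"
      using rv by measurable
    show "(\<Union>A\<in>S. E A) \<in> events" using EM finS by auto
  qed
  also have "\<dots> = (\<Sum>A\<in>S. prob (E A))"
    using EM finS disj by (intro finite_measure_finite_Union) auto
  finally show ?thesis by (simp add: PE S_def I_def)
qed

lemma (in prob_space) prob_sum_bernoulli:
  fixes X :: "nat \<Rightarrow> 'a \<Rightarrow> real" and p :: "nat \<Rightarrow> real"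
  assumes n: "n \<ge> 1"
    and ind: "indep_vars (\<lambda>_. borel) X {1..n}"
    and one: "\<And>j. j \<in> {1..n} \<Longrightarrow> prob {\<omega> \<in> space M. X j \<omega> = 1} = p j"
    and zero: "\<And>j. j \<in> {1..n} \<Longrightarrow> prob {\<omega> \<in> space M. X j \<omega> = 0} = 1 - p j"
  shows "prob {\<omega> \<in> space M. (\<Sum>j=1..n. X j \<omega>) = real k} = pmf (bernoulli_sum_pmf n p) k"
proof -
  let ?P = "Pi_pmf {1..n} False (\<lambda>j. bernoulli_pmf (p j))"
  let ?Y = "\<lambda>j x. of_bool (x j) :: real"
  have p: "0 \<le> p j" "p j \<le> 1" if "j \<in> {1..n}" for j
    using one[OF that] by (metis measure_nonneg, metis prob_le_1)
  have comp: "measure_pmf.prob ?P {x. x j = b} = pmf (bernoulli_pmf (p j)) b"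
    if "j \<in> {1..n}" for j b
  proof -
    have "measure_pmf.prob ?P {x. x j = b} = pmf (map_pmf (\<lambda>x. x j) ?P) b"
      by (simp add: pmf_map vimage_def)
    then show ?thesis using that by (simp add: Pi_pmf_component)
  qed
  have "pmf (bernoulli_sum_pmf n p) k = measure_pmf.prob ?P {x. (\<Sum>j=1..n. of_bool (x j)) = k}"
    by (simp add: bernoulli_sum_pmf_def pmf_map vimage_def)
  also have "{x. (\<Sum>j=1..n. of_bool (x j)) = k} =
      {x \<in> space (measure_pmf ?P). (\<Sum>j=1..n. ?Y j x) = real k}"
  proof -
    have "(\<Sum>j=1..n. ?Y j x) = real (\<Sum>j=1..n. of_bool (x j))" for x by simp
    then show ?thesis by (simp only: of_nat_eq_iff) simp
  qed
  also have "measure_pmf.prob ?P \<dots> =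
    (\<Sum>A | A \<subseteq> {1..n} \<and> card A = k. \<Prod>j=1..n. if j \<in> A then p j else 1 - p j)"
  proof (rule prob_space.prob_sum_bernoulli_subsets[OF measure_pmf.prob_space_axioms n])
    show "prob_space.indep_vars ?P (\<lambda>_. borel) ?Y {1..n}"
      by (rule prob_space.indep_vars_compose2[OF measure_pmf.prob_space_axioms indep_vars_Pi_pmf]) auto
    fix j assume j: "j \<in> {1..n}"
    show "measure_pmf.prob ?P {x \<in> space ?P. ?Y j x = 1} = p j"
      using comp[OF j, of True] p[OF j] by simp
    show "measure_pmf.prob ?P {x \<in> space ?P. ?Y j x = 0} = 1 - p j"
      using comp[OF j, of False] p[OF j] by simp
  qed
  also have "\<dots> = prob {\<omega> \<in> space M. (\<Sum>j=1..n. X j \<omega>) = real k}"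
    using prob_sum_bernoulli_subsets[OF n ind one zero] by simp
  finally show ?thesis by simp
qed

lemma pmf_bernoulli_sum_eq_0: "k > n \<Longrightarrow> pmf (bernoulli_sum_pmf n p) k = 0"
proof -
  assume k: "k > n"
  have "(\<Sum>j=1..n. of_bool (x j)) \<noteq> k" for x
  proof -
    have "(\<Sum>j=1..n. of_bool (x j) :: nat) \<le> (\<Sum>j=1..n. 1)" by (intro sum_mono) auto
    then show ?thesis using k by simp
  qed
  then have "k \<notin> set_pmf (bernoulli_sum_pmf n p)"
    by (fastforce simp: bernoulli_sum_pmf_def)
  then show ?thesis by (simp add: set_pmf_iff)
qed

text \<open>Both series converge, so no junk value of \<^const>\<open>suminf\<close> enters.\<close>

lemma summable_rel_entropy:
  "summable (\<lambda>k. pmf (bernoulli_sum_pmf n p) k * ln (pmf (bernoulli_sum_pmf n p) k / pmf Q k))"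
  by (rule summable_finite[of "{..n}"]) (auto simp: pmf_bernoulli_sum_eq_0)

lemma summable_chi_square_dist:
  "summable (\<lambda>k. (pmf (bernoulli_sum_pmf n p) k - pmf Q k)\<^sup>2 / pmf Q k)"
proof -
  have s: "summable (pmf Q)"
    using pmf_abs_summable[of Q UNIV] by (simp add: abs_summable_on_nat_iff')
  show ?thesis
  proof (rule iffD1[OF summable_cong s])
    show "\<forall>\<^sub>F k in sequentially. pmf Q k = (pmf (bernoulli_sum_pmf n p) k - pmf Q k)\<^sup>2 / pmf Q k"
      using eventually_gt_at_top[of n]
      by eventually_elim (simp add: pmf_bernoulli_sum_eq_0 power2_eq_square)
  qed
qed

end

theory Submission
  imports Defs
begin

text \<open>
  Write \<open>w\<close> for the law of \<open>W\<close>, \<open>v\<close> for the Poisson law, \<open>\<theta> = \<lambda>\<^sub>2 / \<lambda>\<close>, \<open>\<sigma>\<^sup>2 = \<lambda> - \<lambda>\<^sub>2\<close>.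

  Lower bounds. Testing both laws against the second Charlier polynomial \<open>(k - \<lambda>)\<^sup>2 - k\<close> gives
  \<open>D \<ge> \<theta>\<^sup>2 / 16\<close>. If \<open>F\<close> is large, an interval of length of order \<open>max 1 \<sigma>\<close> around \<open>\<lambda>\<close> carries most of the
  mass of \<open>w\<close> but only mass \<open>O(1 / sqrt F)\<close> under \<open>v\<close>, which forces \<open>D\<close> to be of order \<open>ln F\<close> and \<open>\<chi>\<^sup>2\<close>
  of order \<open>sqrt F\<close>.

  Upper bounds. Exponential tilting by \<open>r = k / \<lambda>\<close> together with a local bound \<open>O(1 / \<sigma>)\<close> for the tilted
  sum shows that \<open>w k \<le> C * sqrt F * v k\<close> for all \<open>k\<close>. Let \<open>G\<close> solve the Stein equation
  \<open>\<lambda> * G k - k * G (k - 1) = w k / v k - 1\<close>, and let \<open>W\<^sub>j\<close> be \<open>W\<close> without its \<open>j\<close>-th summand. Then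
  \<open>\<chi>\<^sup>2 = (\<Sum>j. p\<^sub>j\<^sup>2 * E (G (W\<^sub>j + 1) - G (W\<^sub>j)))\<close>, while \<open>\<lambda>\<^sup>2 * E (G (Z + 1) - G Z)\<^sup>2 \<le> \<chi>\<^sup>2\<close>. Passing from
  \<open>W\<^sub>j\<close> to \<open>Z\<close> by Cauchy-Schwarz costs the square root of \<open>\<Sum>k. P(W\<^sub>j = k)\<^sup>2 / v k\<close>, which the ratio bound
  controls; hence \<open>\<chi>\<^sup>2 \<le> C * \<theta>\<^sup>2 * sqrt F\<close>. The bound on \<open>D\<close> follows from \<open>D \<le> ln (1 + \<chi>\<^sup>2)\<close>.
\<close>

section \<open>Bernoulli sums\<close>

text \<open>The weights are the coefficients of the probability generating polynomial. Insertion of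
  an index is then a product rule and \<open>Suc_mult_bern_weight\<close> a derivative; the index
  set is arbitrary because the Stein argument drops one summand.\<close>

definition bern_weight :: "nat set \<Rightarrow> (nat \<Rightarrow> real) \<Rightarrow> nat \<Rightarrow> real" where
  "bern_weight I p k = coeff (\<Prod>j\<in>I. [:1 - p j, p j:]) k"

lemma bern_weight_empty: "bern_weight {} p k = of_bool (k = 0)"
  by (simp add: bern_weight_def coeff_1)

lemma bern_weight_insert_0:
  assumes "finite I" "j \<notin> I"
  shows "bern_weight (insert j I) p 0 = (1 - p j) * bern_weight I p 0"
  using assms by (simp add: bern_weight_def)

lemma bern_weight_insert_Suc:
  assumes "finite I" "j \<notin> I"
  shows "bern_weight (insert j I) p (Suc k) =
    (1 - p j) * bern_weight I p (Suc k) + p j * bern_weight I p k"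
  using assms by (simp add: bern_weight_def coeff_pCons)

lemma bern_weight_nonneg:
  assumes "finite I" "\<forall>j\<in>I. 0 \<le> p j \<and> p j \<le> 1"
  shows "0 \<le> bern_weight I p k"
  using assms
proof (induction I arbitrary: k rule: finite_induct)
  case (insert j I)
  then show ?case
    by (cases k) (auto simp: bern_weight_insert_0 bern_weight_insert_Suc)
qed (simp add: bern_weight_empty)

lemma bern_weight_eq_0:
  assumes "finite I" "card I < k"
  shows "bern_weight I p k = 0"
  using assms
proof (induction I arbitrary: k rule: finite_induct)
  case (insert j I)
  then show ?case
    by (cases k) (auto simp: bern_weight_insert_Suc)
qed (simp add: bern_weight_empty)

text \<open>Expectation under the law. The weights vanish beyond \<open>card I\<close>, so a finite
  sum suffices and no question of summability arises.\<close>

definition bern_exp :: "nat set \<Rightarrow> (nat \<Rightarrow> real) \<Rightarrow> (nat \<Rightarrow> real) \<Rightarrow> real" where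
  "bern_exp I p f = (\<Sum>k\<le>card I. bern_weight I p k * f k)"

lemma bern_exp_eq:
  assumes "finite I" "card I \<le> N"
  shows "(\<Sum>k\<le>N. bern_weight I p k * f k) = bern_exp I p f"
  unfolding bern_exp_def
  using assms by (intro sum.mono_neutral_right) (auto simp: bern_weight_eq_0)

lemma bern_exp_empty: "bern_exp {} p f = f 0"
  by (simp add: bern_exp_def bern_weight_empty)

text \<open>Conditioning on the summand \<open>j\<close>. The moments and the characteristic
  function are computed by induction with this rule.\<close>

lemma bern_exp_insert:
  assumes "finite I" "j \<notin> I"
  shows "bern_exp (insert j I) p f = (1 - p j) * bern_exp I p f + p j * bern_exp I p (\<lambda>k. f (Suc k))"
proof -
  have "bern_exp (insert j I) p f = (\<Sum>k\<le>Suc (card I). bern_weight (insert j I) p k * f k)"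
    using assms by (simp add: bern_exp_def)
  also have "\<dots> = (1 - p j) * (bern_weight I p 0 * f 0) +
      (\<Sum>k\<le>card I. ((1 - p j) * bern_weight I p (Suc k) + p j * bern_weight I p k) * f (Suc k))"
    using assms by (simp add: sum.atMost_Suc_shift bern_weight_insert_0 bern_weight_insert_Suc
        del: sum.atMost_Suc)
  also have "\<dots> = (1 - p j) * (\<Sum>k\<le>Suc (card I). bern_weight I p k * f k) +
      p j * (\<Sum>k\<le>card I. bern_weight I p k * f (Suc k))"
    by (simp add: sum.atMost_Suc_shift algebra_simps sum.distrib sum_distrib_left
        sum_subtractf del: sum.atMost_Suc)
  also have "\<dots> = (1 - p j) * bern_exp I p f + p j * bern_exp I p (\<lambda>k. f (Suc k))"
    using assms by (simp add: bern_exp_eq del: sum.atMost_Suc)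
  finally show ?thesis .
qed

lemma bern_exp_1: "finite I \<Longrightarrow> bern_exp I p (\<lambda>_. 1) = 1"
  by (induction I rule: finite_induct) (simp_all add: bern_exp_empty bern_exp_insert)

lemma sum_bern_weight:
  assumes "finite I" "card I \<le> N"
  shows "(\<Sum>k\<le>N. bern_weight I p k) = 1"
  using bern_exp_eq[OF assms, of p "\<lambda>_. 1"] bern_exp_1[OF assms(1)] by simp

lemma bern_weight_le_1:
  assumes "finite I" "\<forall>j\<in>I. 0 \<le> p j \<and> p j \<le> 1"
  shows "bern_weight I p k \<le> 1"
proof -
  have "bern_weight I p k \<le> (\<Sum>i\<le>max k (card I). bern_weight I p i)"
    using assms by (intro member_le_sum) (auto simp: bern_weight_nonneg)
  then show ?thesis using assms by (simp add: sum_bern_weight)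
qed

text \<open>Compares coefficients in the derivative of the generating polynomial. In expectations it
  is the size-bias identity E(W f(W)) = sum of p_j E f(W_j + 1).\<close>

lemma Suc_mult_bern_weight:
  assumes "finite I"
  shows "real (Suc k) * bern_weight I p (Suc k) = (\<Sum>j\<in>I. p j * bern_weight (I - {j}) p k)"
proof -
  have "real (Suc k) * bern_weight I p (Suc k) = coeff (pderiv (\<Prod>j\<in>I. [:1 - p j, p j:])) k"
    by (simp add: bern_weight_def coeff_pderiv)
  also have "\<dots> = (\<Sum>j\<in>I. p j * bern_weight (I - {j}) p k)"
    by (simp add: pderiv_prod coeff_sum bern_weight_def pderiv_pCons)
  finally show ?thesis .
qed

text \<open>Induction on \<open>k\<close> by the size-bias identity, since dropping a summand only
  lowers the sum of the parameters. The right side is exp(\<lambda>) times the Poisson weight, which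
  settles the ratio bound for \<lambda> <= 1.\<close>

lemma bern_weight_le:
  assumes "finite I" "\<forall>j\<in>I. 0 \<le> p j \<and> p j \<le> 1"
  shows "bern_weight I p k \<le> (\<Sum>j\<in>I. p j) ^ k / fact k"
  using assms
proof (induction k arbitrary: I)
  case 0
  then show ?case by (simp add: bern_weight_le_1)
next
  case (Suc k)
  have "real (Suc k) * bern_weight I p (Suc k) = (\<Sum>j\<in>I. p j * bern_weight (I - {j}) p k)"
    using Suc.prems(1) by (rule Suc_mult_bern_weight)
  also have "\<dots> \<le> (\<Sum>j\<in>I. p j * ((\<Sum>j\<in>I. p j) ^ k / fact k))"
  proof (intro sum_mono mult_left_mono)
    fix j assume j: "j \<in> I"
    have "bern_weight (I - {j}) p k \<le> (\<Sum>i\<in>I - {j}. p i) ^ k / fact k"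
      using Suc by auto
    also have "\<dots> \<le> (\<Sum>j\<in>I. p j) ^ k / fact k"
      using Suc.prems by (intro divide_right_mono power_mono sum_mono2 sum_nonneg) auto
    finally show "bern_weight (I - {j}) p k \<le> (\<Sum>j\<in>I. p j) ^ k / fact k" .
  qed (use Suc in auto)
  also have "\<dots> = (\<Sum>j\<in>I. p j) ^ Suc k / fact k"
    by (simp only: sum_distrib_right [symmetric] sum_divide_distrib [symmetric]
        power_Suc times_divide_eq_right)
  finally show ?case
    by (simp add: field_simps del: of_nat_Suc)
qed

lemma pmf_sum_Pi_bernoulli:
  assumes "finite I" "\<forall>j\<in>I. 0 \<le> p j \<and> p j \<le> 1"
  shows "pmf (map_pmf (\<lambda>x. \<Sum>j\<in>I. of_bool (x j)) (Pi_pmf I False (\<lambda>j. bernoulli_pmf (p j)))) k =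
    bern_weight I p k"
  using assms
proof (induction I arbitrary: k rule: finite_induct)
  case empty
  then show ?case by (simp add: bern_weight_empty)
next
  case (insert j I)
  define M :: "nat pmf" where
    "M = map_pmf (\<lambda>x. \<Sum>j\<in>I. of_bool (x j)) (Pi_pmf I False (\<lambda>j. bernoulli_pmf (p j)))"
  have M: "pmf M k = bern_weight I p k" for k
    unfolding M_def using insert by simp
  have eq: "(\<Sum>i\<in>insert j I. of_bool ((f(j := y)) i)) =
      (of_bool y + (\<Sum>i\<in>I. of_bool (f i)) :: nat)" for f y
  proof -
    have "(\<Sum>i\<in>I. of_bool ((f(j := y)) i)) = (\<Sum>i\<in>I. of_bool (f i) :: nat)"
      using insert by (intro sum.cong) auto
    then show ?thesis using insert.hyps by (simp del: sum_of_bool_eq)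
  qed
  have "map_pmf (\<lambda>x. \<Sum>i\<in>insert j I. of_bool (x i))
      (Pi_pmf (insert j I) False (\<lambda>j. bernoulli_pmf (p j))) =
    bind_pmf (bernoulli_pmf (p j)) (\<lambda>y. map_pmf (\<lambda>m. of_bool y + m) M)"
    unfolding M_def
    using insert.hyps by (simp add: Pi_pmf_insert map_pmf_comp pair_pmf_def map_bind_pmf case_prod_unfold
        map_pmf_def[symmetric] eq del: sum.insert fun_upd_apply sum_of_bool_eq)
  moreover have "(+) (Suc 0) = Suc" "(+) (0::nat) = id" by auto
  ultimately have "pmf (map_pmf (\<lambda>x. \<Sum>i\<in>insert j I. of_bool (x i))
      (Pi_pmf (insert j I) False (\<lambda>j. bernoulli_pmf (p j)))) k =
    p j * pmf (map_pmf Suc M) k + (1 - p j) * pmf M k"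
    using insert.prems by (simp add: pmf_bind pmf.map_id)
  also have "\<dots> = bern_weight (insert j I) p k"
  proof (cases k)
    case 0
    have "0 \<notin> set_pmf (map_pmf Suc M)" by auto
    then have "pmf (map_pmf Suc M) 0 = 0" by (simp add: pmf_eq_0_set_pmf)
    with 0 show ?thesis using insert by (simp add: bern_weight_insert_0 M)
  next
    case (Suc m)
    then show ?thesis using insert by (simp add: bern_weight_insert_Suc M pmf_map_inj')
  qed
  finally show ?case .
qed

section \<open>Moments of the Bernoulli sum\<close>

lemma bern_exp_add: "bern_exp I p (\<lambda>k. f k + g k) = bern_exp I p f + bern_exp I p g"
  by (simp add: bern_exp_def algebra_simps sum.distrib)

lemma bern_exp_cmult: "bern_exp I p (\<lambda>k. c * f k) = c * bern_exp I p f"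
  by (simp add: bern_exp_def algebra_simps sum_distrib_left)

text \<open>Cumulants add over independent summands, and with q = 1 - p those of order 2, 3, 4 of a
  Bernoulli variable are pq, pq(1 - 2p) and pq(1 - 6pq). The induction is joint because each moment
  expands into the lower ones.\<close>

lemma bern_central_moments:
  fixes p :: "nat \<Rightarrow> real"
  assumes "finite I"
  shows "bern_exp I p (\<lambda>k. real k - sum p I) = 0 \<and>
    bern_exp I p (\<lambda>k. (real k - sum p I) ^ 2) = (\<Sum>j\<in>I. p j * (1 - p j)) \<and>
    bern_exp I p (\<lambda>k. (real k - sum p I) ^ 3) = (\<Sum>j\<in>I. p j * (1 - p j) * (1 - 2 * p j)) \<and>
    bern_exp I p (\<lambda>k. (real k - sum p I) ^ 4) =
      3 * (\<Sum>j\<in>I. p j * (1 - p j))\<^sup>2 + (\<Sum>j\<in>I. p j * (1 - p j) * (1 - 6 * (p j * (1 - p j))))"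
  using assms
proof (induction I rule: finite_induct)
  case empty
  then show ?case by (simp add: bern_exp_empty)
next
  case (insert j I)
  define X where "X k = real k - sum p I" for k
  define M where "M i = bern_exp I p (\<lambda>k. X k ^ i)" for i
  have M0: "bern_exp I p (\<lambda>_. 1) = 1" using insert.hyps by (simp add: bern_exp_1)
  have Mc: "bern_exp I p (\<lambda>_. c) = c" for c
    using bern_exp_cmult[of I p c "\<lambda>_. 1"] M0 by simp
  have M1': "bern_exp I p X = M 1" by (simp add: M_def)
  have E1: "bern_exp I p (\<lambda>k. X k + c) = M 1 + c" for c
    by (simp add: bern_exp_add Mc M1')
  have E2: "bern_exp I p (\<lambda>k. (X k + c) ^ 2) = M 2 + 2 * c * M 1 + c ^ 2" for c
  proof -
    have "(\<lambda>k. (X k + c) ^ 2) = (\<lambda>k. X k ^ 2 + (2 * c) * X k + c ^ 2)"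
      by (rule ext) (simp add: power2_eq_square algebra_simps)
    then show ?thesis by (simp only: bern_exp_add bern_exp_cmult Mc M1' M_def[symmetric])
  qed
  have E3: "bern_exp I p (\<lambda>k. (X k + c) ^ 3) = M 3 + 3 * c * M 2 + 3 * c\<^sup>2 * M 1 + c ^ 3" for c
  proof -
    have "(\<lambda>k. (X k + c) ^ 3) = (\<lambda>k. X k ^ 3 + (3 * c) * X k ^ 2 + (3 * c\<^sup>2) * X k + c ^ 3)"
      by (rule ext) (simp add: power2_eq_square power3_eq_cube algebra_simps)
    then show ?thesis by (simp only: bern_exp_add bern_exp_cmult Mc M1' M_def[symmetric])
  qed
  have E4: "bern_exp I p (\<lambda>k. (X k + c) ^ 4) =
      M 4 + 4 * c * M 3 + 6 * c\<^sup>2 * M 2 + 4 * c ^ 3 * M 1 + c ^ 4" for c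
  proof -
    have "(\<lambda>k. (X k + c) ^ 4) =
        (\<lambda>k. X k ^ 4 + (4 * c) * X k ^ 3 + (6 * c\<^sup>2) * X k ^ 2 + (4 * c ^ 3) * X k + c ^ 4)"
      by (rule ext) (simp add: eval_nat_numeral algebra_simps)
    then show ?thesis by (simp only: bern_exp_add bern_exp_cmult Mc M1' M_def[symmetric])
  qed
  \<comment> \<open>Inserting \<open>j\<close> raises the mean by \<open>p j\<close>, so the old
    centred value moves by \<open>- p j\<close> or by \<open>1 - p j\<close>.\<close>
  have shift: "real k - sum p (insert j I) = X k + (- p j)"
      "X (Suc k) + (- p j) = X k + (1 - p j)" for k
    using insert.hyps by (simp_all add: X_def)
  have IH: "M 1 = 0" "M 2 = (\<Sum>j\<in>I. p j * (1 - p j))"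
    "M 3 = (\<Sum>j\<in>I. p j * (1 - p j) * (1 - 2 * p j))"
    "M 4 = 3 * (\<Sum>j\<in>I. p j * (1 - p j))\<^sup>2 + (\<Sum>j\<in>I. p j * (1 - p j) * (1 - 6 * (p j * (1 - p j))))"
    using insert.IH by (simp_all add: M_def X_def)
  have J: "(\<Sum>j\<in>insert j I. p j * (1 - p j)) = M 2 + p j * (1 - p j)"
    "(\<Sum>j\<in>insert j I. p j * (1 - p j) * (1 - 2 * p j)) = M 3 + p j * (1 - p j) * (1 - 2 * p j)"
    "(\<Sum>j\<in>insert j I. p j * (1 - p j) * (1 - 6 * (p j * (1 - p j)))) =
      M 4 - 3 * (M 2)\<^sup>2 + p j * (1 - p j) * (1 - 6 * (p j * (1 - p j)))"
    using insert.hyps by (simp_all add: IH)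
  show ?case
    unfolding bern_exp_insert[OF insert.hyps] shift E1 E2 E3 E4 J
    unfolding IH(1)
    by (intro conjI) algebra+
qed

text \<open>The first value is variance minus mean. In the second, 6 = 1 + 1 + 4:
  \<open>3 * s\<^sup>2 - 2 * l * s\<close> is at most \<open>l\<^sup>2\<close>, a further
  \<open>l\<^sup>2\<close> is explicit, and each remaining summand is at most
  \<open>4 * (p j * l)\<close>.\<close>

lemma bern_exp_charlier:
  fixes p :: "nat \<Rightarrow> real"
  assumes "finite I" and p: "\<forall>j\<in>I. 0 \<le> p j \<and> p j \<le> 1"
  defines "f \<equiv> \<lambda>k. (real k - sum p I)\<^sup>2 - real k"
  shows "bern_exp I p f = - (\<Sum>j\<in>I. (p j)\<^sup>2)"
    and "bern_exp I p (\<lambda>k. (f k)\<^sup>2) \<le> 6 * (sum p I)\<^sup>2"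
proof -
  define l where "l = sum p I"
  define s where "s = (\<Sum>j\<in>I. p j * (1 - p j))"
  define X where "X k = real k - l" for k
  note mom = bern_central_moments[OF assms(1), of p, folded l_def, folded s_def]
  have M: "bern_exp I p X = 0" "bern_exp I p (\<lambda>k. X k ^ 2) = s"
    "bern_exp I p (\<lambda>k. X k ^ 3) = (\<Sum>j\<in>I. p j * (1 - p j) * (1 - 2 * p j))"
    "bern_exp I p (\<lambda>k. X k ^ 4) = 3 * s\<^sup>2 + (\<Sum>j\<in>I. p j * (1 - p j) * (1 - 6 * (p j * (1 - p j))))"
    using mom unfolding X_def by auto
  have Mc: "bern_exp I p (\<lambda>_. c) = c" for c
    using bern_exp_cmult[of I p c "\<lambda>_. 1"] bern_exp_1[OF assms(1), of p] by simp
  have "f = (\<lambda>k. X k ^ 2 + (-1) * X k + (- l))"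
    by (rule ext) (simp add: f_def X_def l_def)
  then have "bern_exp I p f = s - l"
    by (simp only: bern_exp_add bern_exp_cmult Mc M)
  also have "\<dots> = - (\<Sum>j\<in>I. (p j)\<^sup>2)"
    by (simp add: s_def l_def sum_subtractf [symmetric] sum_negf [symmetric] power2_eq_square algebra_simps)
  finally show "bern_exp I p f = - (\<Sum>j\<in>I. (p j)\<^sup>2)" .
  have s0: "0 \<le> s" unfolding s_def using p by (intro sum_nonneg) auto
  have sl: "s \<le> l" unfolding s_def l_def using p by (intro sum_mono) (auto simp: mult_left_le)
  have "(\<lambda>k. (f k)\<^sup>2) =
      (\<lambda>k. X k ^ 4 + (-2) * X k ^ 3 + (1 - 2 * l) * X k ^ 2 + (2 * l) * X k + l\<^sup>2)"
    by (rule ext) (simp add: f_def X_def l_def eval_nat_numeral algebra_simps)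
  then have "bern_exp I p (\<lambda>k. (f k)\<^sup>2) =
      3 * s\<^sup>2 + (\<Sum>j\<in>I. p j * (1 - p j) * (1 - 6 * (p j * (1 - p j)))) +
      (-2) * (\<Sum>j\<in>I. p j * (1 - p j) * (1 - 2 * p j)) + (1 - 2 * l) * s + (2 * l) * 0 + l\<^sup>2"
    by (simp only: bern_exp_add bern_exp_cmult Mc M)
  also have "\<dots> = 3 * s\<^sup>2 - 2 * l * s + l\<^sup>2 +
      (\<Sum>j\<in>I. p j * (1 - p j) * (1 - 6 * (p j * (1 - p j))) + (-2) * (p j * (1 - p j) * (1 - 2 * p j))
        + p j * (1 - p j))"
    by (simp only: sum.distrib sum_distrib_left [symmetric] s_def [symmetric])
      (simp add: algebra_simps)
  finally have e: "bern_exp I p (\<lambda>k. (f k)\<^sup>2) = 3 * s\<^sup>2 - 2 * l * s + l\<^sup>2 +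
      (\<Sum>j\<in>I. p j * (1 - p j) * (1 - 6 * (p j * (1 - p j))) + (-2) * (p j * (1 - p j) * (1 - 2 * p j))
        + p j * (1 - p j))" .
  have "(\<Sum>j\<in>I. p j * (1 - p j) * (1 - 6 * (p j * (1 - p j))) + (-2) * (p j * (1 - p j) * (1 - 2 * p j))
        + p j * (1 - p j)) \<le> (\<Sum>j\<in>I. 4 * (p j * l))"
  proof (rule sum_mono)
    fix j assume j: "j \<in> I"
    have pl: "p j \<le> l" unfolding l_def using j p assms(1) by (intro member_le_sum) auto
    have "p j * (1 - p j) * (1 - 6 * (p j * (1 - p j))) + (-2) * (p j * (1 - p j) * (1 - 2 * p j))
        + p j * (1 - p j) = 4 * (p j * (p j * (1 - p j))) - 6 * (p j * (1 - p j))\<^sup>2"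
      by (simp add: power2_eq_square algebra_simps)
    also have "\<dots> \<le> 4 * (p j * (p j * (1 - p j)))" by simp
    also have "\<dots> \<le> 4 * (p j * l)"
    proof (intro mult_left_mono)
      have "p j * (1 - p j) \<le> p j * 1" using p j by (intro mult_left_mono) auto
      then show "p j * (1 - p j) \<le> l" using pl by simp
    qed (use p j in auto)
    finally show "p j * (1 - p j) * (1 - 6 * (p j * (1 - p j))) + (-2) * (p j * (1 - p j) * (1 - 2 * p j))
        + p j * (1 - p j) \<le> 4 * (p j * l)" .
  qed
  also have "\<dots> = 4 * l\<^sup>2"
    by (simp only: sum_distrib_left [symmetric] sum_distrib_right [symmetric] l_def [symmetric]
        power2_eq_square)
  finally have "bern_exp I p (\<lambda>k. (f k)\<^sup>2) \<le> 3 * s\<^sup>2 - 2 * l * s + l\<^sup>2 + 4 * l\<^sup>2"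
    using e by linarith
  moreover have "3 * s\<^sup>2 - 2 * l * s \<le> l\<^sup>2"
  proof -
    have "s * s \<le> l * s" "s * l \<le> l * l" using s0 sl by (auto intro: mult_right_mono)
    then show ?thesis by (simp add: power2_eq_square algebra_simps)
  qed
  ultimately show "bern_exp I p (\<lambda>k. (f k)\<^sup>2) \<le> 6 * (sum p I)\<^sup>2" by (simp add: l_def)
qed

section \<open>Poisson weights\<close>

text \<open>A plain function of a real parameter, which may vanish, as \<open>l - q\<close> can in
  \<open>pois_diff_le\<close>.\<close>

definition pois :: "real \<Rightarrow> nat \<Rightarrow> real" where
  "pois l k = l ^ k / fact k * exp (- l)"

lemma pois_pos: "0 < l \<Longrightarrow> 0 < pois l k"
  by (simp add: pois_def)

lemma pois_Suc: "real (Suc k) * pois l (Suc k) = l * pois l k"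
  by (simp add: pois_def field_simps del: of_nat_Suc)

lemma pois_sums: "pois l sums 1"
proof -
  have "(\<lambda>k. l ^ k /\<^sub>R fact k * exp (- l)) sums (exp l * exp (- l))"
    by (intro sums_mult2 exp_converges)
  then show ?thesis
    by (simp add: pois_def [abs_def] divide_inverse_commute scaleR_conv_of_real exp_minus_inverse)
qed

text \<open>The Poisson Stein identity E(Z g(Z)) = \<lambda> E g(Z + 1), used to raise the order of
  a moment by one.\<close>

lemma pois_sums_shift:
  assumes "(\<lambda>k. pois l k * g (Suc k)) sums s"
  shows "(\<lambda>k. pois l k * (real k * g k)) sums (l * s)"
proof -
  have "(\<lambda>k. l * (pois l k * g (Suc k))) sums (l * s)"
    using assms by (rule sums_mult)
  also have "(\<lambda>k. l * (pois l k * g (Suc k))) = (\<lambda>k. pois l (Suc k) * (real (Suc k) * g (Suc k)))"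
  proof
    fix k
    have "l * (pois l k * g (Suc k)) = (l * pois l k) * g (Suc k)" by simp
    also have "\<dots> = pois l (Suc k) * (real (Suc k) * g (Suc k))"
      unfolding pois_Suc [symmetric] by (simp only: mult_ac)
    finally show "l * (pois l k * g (Suc k)) = pois l (Suc k) * (real (Suc k) * g (Suc k))" .
  qed
  finally show ?thesis
    using sums_Suc_iff[of "\<lambda>k. pois l k * (real k * g k)" "l * s"] by simp
qed

text \<open>By the shift identity the raw moment of order m + 1 is \<lambda> E(Z + 1)^m. This gives
  the moments up to order four, and both polynomials are expanded in them.\<close>

lemma pois_charlier:
  defines "f \<equiv> \<lambda>l k. (real k - l)\<^sup>2 - real k"
  shows "(\<lambda>k. pois l k * f l k) sums 0"
    and "(\<lambda>k. pois l k * (f l k)\<^sup>2) sums (2 * l\<^sup>2)"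
proof -
  let ?v = "pois l"
  have m0: "(\<lambda>k. ?v k * 1) sums 1" using pois_sums by simp
  have m1: "(\<lambda>k. ?v k * real k) sums l"
    using pois_sums_shift[of l "\<lambda>_. 1" 1] m0 by simp
  have "(\<lambda>k. ?v k * real k + ?v k * 1) sums (l + 1)"
    by (intro sums_add m1 m0)
  then have m2: "(\<lambda>k. ?v k * real k ^ 2) sums (l * (l + 1))"
    using pois_sums_shift[of l "\<lambda>k. real k" "l + 1"]
    by (simp add: power2_eq_square algebra_simps)
  have "(\<lambda>k. ?v k * real k ^ 2 + 2 * (?v k * real k) + ?v k * 1) sums (l * (l + 1) + 2 * l + 1)"
    by (intro sums_add m1 m0 m2 sums_mult)
  also have "(\<lambda>k. ?v k * real k ^ 2 + 2 * (?v k * real k) + ?v k * 1) = (\<lambda>k. ?v k * real (Suc k) ^ 2)"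
    by (rule ext) (simp add: power2_eq_square algebra_simps)
  finally have m3: "(\<lambda>k. ?v k * real k ^ 3) sums (l * (l * (l + 1) + 2 * l + 1))"
    using pois_sums_shift[of l "\<lambda>k. real k ^ 2" "l * (l + 1) + 2 * l + 1"]
    by (simp add: power2_eq_square power3_eq_cube mult.assoc)
  define t where "t = l * (l * (l + 1) + 2 * l + 1) + 3 * (l * (l + 1)) + 3 * l + 1"
  have "(\<lambda>k. ?v k * real k ^ 3 + 3 * (?v k * real k ^ 2) + 3 * (?v k * real k) + ?v k * 1) sums t"
    unfolding t_def by (intro sums_add m1 m0 m2 m3 sums_mult)
  also have "(\<lambda>k. ?v k * real k ^ 3 + 3 * (?v k * real k ^ 2) + 3 * (?v k * real k) + ?v k * 1) =
      (\<lambda>k. ?v k * real (Suc k) ^ 3)"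
    by (rule ext) (simp add: power2_eq_square power3_eq_cube algebra_simps)
  finally have m4: "(\<lambda>k. ?v k * real k ^ 4) sums (l * t)"
    using pois_sums_shift[of l "\<lambda>k. real k ^ 3" t]
    by (simp add: eval_nat_numeral)
  have "(\<lambda>k. ?v k * real k ^ 2 + (- (1 + 2 * l)) * (?v k * real k) + l\<^sup>2 * (?v k * 1))
      sums (l * (l + 1) + (- (1 + 2 * l)) * l + l\<^sup>2 * 1)"
    by (intro sums_add m1 m0 m2 sums_mult)
  then show "(\<lambda>k. ?v k * f l k) sums 0"
    by (simp add: f_def power2_eq_square algebra_simps)
  have "(\<lambda>k. ?v k * real k ^ 4 + (- 2 * (1 + 2 * l)) * (?v k * real k ^ 3) +
      ((1 + 2 * l)\<^sup>2 + 2 * l\<^sup>2) * (?v k * real k ^ 2) + (- 2 * l\<^sup>2 * (1 + 2 * l)) * (?v k * real k) +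
      l ^ 4 * (?v k * 1))
    sums (l * t + (- 2 * (1 + 2 * l)) * (l * (l * (l + 1) + 2 * l + 1)) +
      ((1 + 2 * l)\<^sup>2 + 2 * l\<^sup>2) * (l * (l + 1)) + (- 2 * l\<^sup>2 * (1 + 2 * l)) * l + l ^ 4 * 1)"
    by (intro sums_add m1 m0 m2 m3 m4 sums_mult)
  also have "(\<lambda>k. ?v k * real k ^ 4 + (- 2 * (1 + 2 * l)) * (?v k * real k ^ 3) +
      ((1 + 2 * l)\<^sup>2 + 2 * l\<^sup>2) * (?v k * real k ^ 2) + (- 2 * l\<^sup>2 * (1 + 2 * l)) * (?v k * real k) +
      l ^ 4 * (?v k * 1)) = (\<lambda>k. ?v k * (f l k)\<^sup>2)"
    unfolding f_def by (rule ext) algebra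
  also have "l * t + (- 2 * (1 + 2 * l)) * (l * (l * (l + 1) + 2 * l + 1)) +
      ((1 + 2 * l)\<^sup>2 + 2 * l\<^sup>2) * (l * (l + 1)) + (- 2 * l\<^sup>2 * (1 + 2 * l)) * l + l ^ 4 * 1 = 2 * l\<^sup>2"
    unfolding t_def by algebra
  finally show "(\<lambda>k. ?v k * (f l k)\<^sup>2) sums (2 * l\<^sup>2)" .
qed

text \<open>For k <= \<lambda> the next \<open>N\<close> ratios of consecutive weights are at least
  1/(1 + 1/sqrt \<lambda>). Hence at least sqrt \<lambda> weights are no smaller than exp(-1) times
  the one at \<open>k\<close>, while their total is at most 1. Beyond \<lambda> the weights
  decrease.\<close>

lemma pois_le_inverse_sqrt:
  assumes l: "0 < l"
  shows "pois l k \<le> exp 1 / sqrt l"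
proof -
  have small: "pois l k \<le> exp 1 / sqrt l" if k: "real k \<le> l" for k
  proof -
    define N where "N = nat \<lfloor>sqrt l\<rfloor>"
    have N: "real N \<le> sqrt l" "sqrt l \<le> real (Suc N)"
      using l unfolding N_def by (auto simp: of_nat_nat) linarith+
    have step: "pois l k * (1 / (1 + 1 / sqrt l)) ^ j \<le> pois l (k + j)" if "j \<le> N" for j
      using that
    proof (induction j)
      case (Suc j)
      have "real (Suc (k + j)) \<le> l + sqrt l" using k Suc.prems N by simp
      then have "l / (l + sqrt l) \<le> l / real (Suc (k + j))"
        using l by (intro divide_left_mono) (auto intro: mult_pos_pos add_pos_pos)
      moreover have "1 / (1 + 1 / sqrt l) = l / (l + sqrt l)"
      proof -
        define x where "x = sqrt l"
        have "0 < x" "l = x * x" using l by (auto simp: x_def)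
        moreover from this have "0 < x + x * x" by (simp add: add_pos_pos)
        ultimately show ?thesis unfolding x_def [symmetric] by (simp add: field_simps)
      qed
      ultimately have le: "1 / (1 + 1 / sqrt l) \<le> l / real (Suc (k + j))" by simp
      have "pois l k * (1 / (1 + 1 / sqrt l)) ^ Suc j =
          (pois l k * (1 / (1 + 1 / sqrt l)) ^ j) * (1 / (1 + 1 / sqrt l))" by simp
      also have "\<dots> \<le> pois l (k + j) * (l / real (Suc (k + j)))"
        using Suc l le pois_pos[of l]
        by (intro mult_mono) (auto intro: less_imp_le)
      also have "\<dots> = pois l (k + Suc j)"
        using pois_Suc[of "k + j" l] by (simp add: field_simps)
      finally show ?case .
    qed simp
    have exp1: "exp (-1) \<le> (1 / (1 + 1 / sqrt l)) ^ j" if "j \<le> N" for j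
    proof -
      have "(1 + 1 / sqrt l) ^ j \<le> exp (1 / sqrt l) ^ j"
        using l by (intro power_mono exp_ge_add_one_self) auto
      also have "\<dots> = exp (real j / sqrt l)" by (simp add: exp_of_nat_mult [symmetric])
      also have "\<dots> \<le> exp 1" using that N l by (simp add: field_simps)
      finally show ?thesis
        using l by (simp add: exp_minus power_one_over field_simps add_pos_pos)
    qed
    have "sqrt l * (pois l k * exp (-1)) \<le> real (Suc N) * (pois l k * exp (-1))"
      using N(2) pois_pos[OF l, of k] by (intro mult_right_mono) auto
    also have "\<dots> = (\<Sum>j\<le>N. pois l k * exp (-1))" by simp
    also have "\<dots> \<le> (\<Sum>j\<le>N. pois l (k + j))"
    proof (rule sum_mono)
      fix j assume "j \<in> {..N}"
      then have "j \<le> N" by simp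
      have "pois l k * exp (-1) \<le> pois l k * (1 / (1 + 1 / sqrt l)) ^ j"
        using exp1[OF \<open>j \<le> N\<close>] pois_pos[OF l, of k] by (intro mult_left_mono) auto
      then show "pois l k * exp (-1) \<le> pois l (k + j)" using step[OF \<open>j \<le> N\<close>] by simp
    qed
    also have "\<dots> = sum (pois l) ((\<lambda>j. k + j) ` {..N})"
      by (subst sum.reindex) auto
    also have "\<dots> \<le> suminf (pois l)"
      using pois_sums[of l] pois_pos[OF l]
      by (intro sum_le_suminf) (auto intro: less_imp_le sums_summable)
    also have "\<dots> = 1" using pois_sums by (rule sums_unique [symmetric])
    finally show ?thesis using l by (simp add: exp_minus field_simps)
  qed
  show ?thesis
  proof (induction k)
    case 0
    show ?case using l by (intro small) auto
  next
    case (Suc k)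
    show ?case
    proof (cases "real (Suc k) \<le> l")
      case True
      then show ?thesis by (rule small)
    next
      case False
      have "pois l (Suc k) * real (Suc k) = l * pois l k" using pois_Suc[of k l] by (simp add: mult.commute)
      also have "\<dots> \<le> real (Suc k) * pois l k"
        using False pois_pos[OF l, of k] by (intro mult_right_mono) auto
      finally have "pois l (Suc k) \<le> pois l k" by (simp add: mult.commute del: of_nat_Suc)
      with Suc show ?thesis by simp
    qed
  qed
qed

text \<open>Induction on the logarithm with ln(k + 1) - ln k >= 2/(2k + 1). The constant
  \<open>exp 1\<close> makes the case k = 1 an equality.\<close>

lemma fact_le_stirling:
  assumes "k \<ge> 1"
  shows "fact k \<le> exp 1 * sqrt (real k) * (real k / exp 1) ^ k"
proof -
  have "ln (fact k :: real) \<le> (real k + 1 / 2) * ln (real k) - real k + 1"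
    using assms
  proof (induction k rule: dec_induct)
    case base
    then show ?case by simp
  next
    case (step k)
    have k: "0 < real k" using step by simp
    have "2 * (real (Suc k) - real k) / (real k + real (Suc k)) \<le> ln (real (Suc k)) - ln (real k)"
      using k by (intro ln_inverse_approx_ge) auto
    then have "1 \<le> (real k + 1 / 2) * (ln (real (Suc k)) - ln (real k))"
      using k by (simp add: field_simps)
    moreover have "ln (fact (Suc k) :: real) = ln (real (Suc k)) + ln (fact k)"
      by (simp add: ln_mult del: of_nat_Suc)
    ultimately show ?case using step.IH by (simp add: algebra_simps)
  qed
  then have "fact k \<le> exp ((real k + 1 / 2) * ln (real k) - real k + 1)"
    by (metis exp_le_cancel_iff exp_ln fact_gt_zero)
  also have "\<dots> = exp 1 * sqrt (real k) * (real k / exp 1) ^ k"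
  proof -
    have k: "0 < real k" using assms by simp
    have "exp ((real k + 1 / 2) * ln (real k) - real k + 1) =
        exp (real k * ln (real k)) * exp (ln (real k) / 2) / exp (real k) * exp 1"
      by (simp add: exp_add exp_diff algebra_simps)
    also have "exp (real k * ln (real k)) = real k ^ k"
      using k by (simp add: exp_of_nat_mult)
    also have "exp (ln (real k) / 2) = sqrt (real k)"
      using k by (simp flip: ln_sqrt)
    also have "exp (real k) = exp 1 ^ k"
      using exp_of_nat_mult[of k "1::real"] by simp
    finally show ?thesis by (simp add: power_divide)
  qed
  finally show ?thesis .
qed

section \<open>Ratio of the weights\<close>

text \<open>The product is the characteristic function. The free phase \<open>c\<close> is needed in
  the induction, where a success of the new summand replaces \<open>c\<close> by
  \<open>c + t\<close>.\<close>

lemma bern_exp_cos: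
  assumes "finite I"
  shows "bern_exp I p (\<lambda>i. cos (real i * t + c)) =
    Re (cis c * (\<Prod>j\<in>I. complex_of_real (1 - p j) + complex_of_real (p j) * cis t))"
  using assms
proof (induction I arbitrary: c rule: finite_induct)
  case (insert j I)
  have "bern_exp (insert j I) p (\<lambda>i. cos (real i * t + c)) =
      (1 - p j) * bern_exp I p (\<lambda>i. cos (real i * t + c)) +
      p j * bern_exp I p (\<lambda>i. cos (real i * t + (c + t)))"
    using insert.hyps by (simp add: bern_exp_insert algebra_simps)
  also have "\<dots> = Re (complex_of_real (1 - p j) *
        (cis c * (\<Prod>j\<in>I. complex_of_real (1 - p j) + complex_of_real (p j) * cis t)) +
      complex_of_real (p j) *
        (cis (c + t) * (\<Prod>j\<in>I. complex_of_real (1 - p j) + complex_of_real (p j) * cis t)))"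
    by (simp only: insert.IH plus_complex.sel Re_complex_of_real Im_complex_of_real times_complex.sel)
  also have "\<dots> = Re (cis c *
      (\<Prod>j\<in>insert j I. complex_of_real (1 - p j) + complex_of_real (p j) * cis t))"
    unfolding prod.insert[OF insert.hyps] cis_mult [symmetric] by (simp only: algebra_simps)
  finally show ?case .
qed (simp add: bern_exp_empty)

text \<open>The squared modulus is exactly 1 - 2p(1 - p)(1 - cos t), and 1 + x <= exp x.\<close>

lemma norm_bernoulli_cf_le:
  assumes "0 \<le> p" "p \<le> 1"
  shows "norm (complex_of_real (1 - p) + complex_of_real p * cis t) \<le> exp (- (p * (1 - p) * (1 - cos t)))"
proof (rule power2_le_imp_le)
  have "(norm (complex_of_real (1 - p) + complex_of_real p * cis t))\<^sup>2 =
      (1 - p + p * cos t)\<^sup>2 + p\<^sup>2 * (sin t)\<^sup>2"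
    by (simp add: cmod_power2 power_mult_distrib)
  also have "\<dots> = 1 + (- (2 * (p * (1 - p) * (1 - cos t))))"
    by (simp add: sin_squared_eq) algebra
  also have "\<dots> \<le> exp (- (2 * (p * (1 - p) * (1 - cos t))))"
    by (rule exp_ge_add_one_self)
  also have "\<dots> = (exp (- (p * (1 - p) * (1 - cos t))))\<^sup>2"
    by (simp add: exp_double [symmetric])
  finally show "(norm (complex_of_real (1 - p) + complex_of_real p * cis t))\<^sup>2 \<le>
      (exp (- (p * (1 - p) * (1 - cos t))))\<^sup>2" .
qed simp

lemma one_minus_cos_ge:
  assumes "\<bar>t\<bar> \<le> pi"
  shows "t\<^sup>2 / 16 \<le> 1 - cos t"
proof -
  have "{..<4::nat} = {0, 1, 2, 3}" by auto
  then have S: "(\<Sum>m<4. cos_coeff m * t ^ m) = 1 - t\<^sup>2 / 2"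
    by (simp add: cos_coeff_def)
  obtain s where "cos t = (\<Sum>m<4. cos_coeff m * t ^ m) + (cos (s + 1 / 2 * real 4 * pi) / fact 4) * t ^ 4"
    using Maclaurin_cos_expansion[of t 4] by blast
  then have "cos t = 1 - t\<^sup>2 / 2 + cos (s + 1 / 2 * real 4 * pi) / 24 * t ^ 4"
    unfolding S by (simp add: fact_numeral)
  moreover have "cos (s + 1 / 2 * real 4 * pi) / 24 * t ^ 4 \<le> 1 / 24 * t ^ 4"
    by (intro mult_right_mono divide_right_mono) auto
  \<comment> \<open>The fourth-order term may use up 7/16 of the leading 1/2; this works because
    3.2^2 / 24 < 7/16.\<close>
  moreover have "1 / 24 * t ^ 4 \<le> 7 / 16 * t\<^sup>2"
  proof -
    have "\<bar>t\<bar> \<le> 3.2" using assms order_trans[OF pi_approx(2), of "3.2"] by simp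
    then have "t\<^sup>2 \<le> 3.2\<^sup>2" by (metis abs_le_square_iff abs_of_pos zero_less_numeral zero_less_divide_iff)
    then have "t\<^sup>2 / 24 * t\<^sup>2 \<le> 7 / 16 * t\<^sup>2"
      by (intro mult_right_mono) (auto simp: power2_eq_square)
    then show ?thesis by (simp add: eval_nat_numeral)
  qed
  ultimately show ?thesis by simp
qed

lemma has_integral_cos_int:
  "((\<lambda>t. cos (of_int m * t)) has_integral (if m = 0 then 2 * pi else 0)) {- pi..pi}"
proof (cases "m = 0")
  case True
  have "((\<lambda>t::real. 1::real) has_integral (pi - (- pi)) * 1) {- pi..pi}"
    using has_integral_const_real[of "1::real" "- pi" pi] by simp
  then show ?thesis using True by simp
next
  case False
  have "((\<lambda>t. cos (of_int m * t)) has_integral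
      (sin (of_int m * pi) / of_int m - sin (of_int m * (- pi)) / of_int m)) {- pi..pi}"
    using False
    by (intro fundamental_theorem_of_calculus)
      (auto intro!: derivative_eq_intros simp: has_real_derivative_iff_has_vector_derivative [symmetric])
  moreover have "sin (of_int m * pi) = 0" by (metis mult.commute sin_npi_int)
  ultimately show ?thesis using False by simp
qed

text \<open>Fourier inversion, with \<open>exp (-x) \<le> 1 / (1 + x)\<close> in place of a Gaussian integral.\<close>

lemma bern_weight_le_inverse_sd:
  assumes I: "finite I" and p: "\<forall>j\<in>I. 0 \<le> p j \<and> p j \<le> 1"
    and s: "s = (\<Sum>j\<in>I. p j * (1 - p j))" "0 < s"
  shows "bern_weight I p k \<le> 2 / sqrt s"
proof -
  \<comment> \<open>\<open>a\<^sup>2 = s / 16\<close> matches the constant in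
    \<open>one_minus_cos_ge\<close>, so the integrand is at most exp(-(a t)^2).\<close>
  define a where "a = sqrt s / 4"
  have a: "0 < a" using s by (simp add: a_def)
  \<comment> \<open>The maximum keeps the index \<open>k\<close> in the sum even if it exceeds
    \<open>card I\<close>.\<close>
  define N where "N = max k (card I)"
  have "((\<lambda>t. \<Sum>i\<le>N. bern_weight I p i * cos (of_int (int i - int k) * t)) has_integral
      (\<Sum>i\<le>N. bern_weight I p i * (if int i - int k = 0 then 2 * pi else 0))) {- pi..pi}"
    by (intro has_integral_sum has_integral_mult_right has_integral_cos_int) auto
  also have "(\<Sum>i\<le>N. bern_weight I p i * (if int i - int k = 0 then 2 * pi else 0)) =
      (\<Sum>i\<le>N. if i = k then bern_weight I p i * (2 * pi) else 0)"
    by (intro sum.cong) auto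
  also have "\<dots> = bern_weight I p k * (2 * pi)"
    by (simp add: N_def)
  finally have int1: "((\<lambda>t. \<Sum>i\<le>N. bern_weight I p i * cos (of_int (int i - int k) * t)) has_integral
      bern_weight I p k * (2 * pi)) {- pi..pi}" .
  have "((\<lambda>t. 1 / (1 + (a * t)\<^sup>2)) has_integral (arctan (a * pi) / a - arctan (a * (- pi)) / a)) {- pi..pi}"
    using a
    by (intro fundamental_theorem_of_calculus)
      (auto intro!: derivative_eq_intros
        simp: has_real_derivative_iff_has_vector_derivative [symmetric] inverse_eq_divide)
  then have int2: "((\<lambda>t. 1 / (1 + (a * t)\<^sup>2)) has_integral (2 * arctan (a * pi) / a)) {- pi..pi}"
    by (simp add: arctan_minus)
  have "bern_weight I p k * (2 * pi) \<le> 2 * arctan (a * pi) / a"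
  proof (rule has_integral_le[OF int1 int2])
    fix t assume "t \<in> {- pi..pi}"
    then have t: "\<bar>t\<bar> \<le> pi" by auto
    have "(\<Sum>i\<le>N. bern_weight I p i * cos (of_int (int i - int k) * t)) =
        (\<Sum>i\<le>N. bern_weight I p i * cos (real i * t + (- real k * t)))"
      by (simp add: algebra_simps)
    also have "\<dots> = bern_exp I p (\<lambda>i. cos (real i * t + (- real k * t)))"
      using I by (intro bern_exp_eq) (auto simp: N_def)
    also have "\<dots> = Re (cis (- real k * t) *
        (\<Prod>j\<in>I. complex_of_real (1 - p j) + complex_of_real (p j) * cis t))"
      using I by (rule bern_exp_cos)
    also have "\<dots> \<le> norm (cis (- real k * t) *
        (\<Prod>j\<in>I. complex_of_real (1 - p j) + complex_of_real (p j) * cis t))"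
      by (rule complex_Re_le_cmod)
    also have "\<dots> = (\<Prod>j\<in>I. norm (complex_of_real (1 - p j) + complex_of_real (p j) * cis t))"
      by (simp add: norm_mult prod_norm)
    also have "\<dots> \<le> (\<Prod>j\<in>I. exp (- (p j * (1 - p j) * (1 - cos t))))"
      using p by (intro prod_mono conjI norm_bernoulli_cf_le) auto
    also have "\<dots> = exp (- (s * (1 - cos t)))"
      using I by (simp add: s exp_sum [symmetric] sum_distrib_right sum_negf)
    also have "\<dots> \<le> exp (- (a * t)\<^sup>2)"
    proof -
      have "s * (t\<^sup>2 / 16) \<le> s * (1 - cos t)"
        using s one_minus_cos_ge[OF t] by (intro mult_left_mono) auto
      moreover have "s * (t\<^sup>2 / 16) = (a * t)\<^sup>2"
        using s by (simp add: a_def power_mult_distrib power_divide)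
      ultimately show ?thesis by simp
    qed
    also have "\<dots> = 1 / exp ((a * t)\<^sup>2)" by (simp add: exp_minus inverse_eq_divide)
    also have "\<dots> \<le> 1 / (1 + (a * t)\<^sup>2)"
      using exp_ge_add_one_self[of "(a * t)\<^sup>2"] by (intro frac_le) (simp_all add: add_pos_nonneg)
    finally show "(\<Sum>i\<le>N. bern_weight I p i * cos (of_int (int i - int k) * t)) \<le> 1 / (1 + (a * t)\<^sup>2)" .
  qed
  also have "\<dots> \<le> pi / a"
    using arctan_ubound[of "a * pi"] a by (intro divide_right_mono) auto
  finally have "bern_weight I p k * 2 \<le> 1 / a"
    using a by (simp add: field_simps)
  then show ?thesis by (simp add: a_def)
qed

section \<open>Exponential tilting and the ratio bound\<close>

text \<open>Replacing x by r x in the generating polynomial turns each factor into D(1 - t + t x)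
  with D = 1 - p + p r and t = p r / D. A tilted Bernoulli sum is therefore again a Bernoulli
  sum.\<close>

lemma bern_weight_tilt:
  assumes "finite I" "\<forall>j\<in>I. 0 \<le> p j \<and> p j \<le> 1" "0 < r"
  shows "bern_weight I p k * r ^ k =
    (\<Prod>j\<in>I. 1 - p j + p j * r) * bern_weight I (\<lambda>j. p j * r / (1 - p j + p j * r)) k"
  using assms
proof (induction I arbitrary: k rule: finite_induct)
  case empty
  then show ?case by (cases k) (simp_all add: bern_weight_empty)
next
  case (insert j I)
  let ?D = "1 - p j + p j * r"
  have D: "0 < ?D"
  proof (cases "p j = 0")
    case False
    then have "0 < p j * r" using insert.prems by (simp add: less_le)
    then show ?thesis using insert.prems by (simp add: add_nonneg_pos)
  qed simp
  then have q: "1 - p j * r / ?D = (1 - p j) / ?D" by (simp add: field_simps)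
  note IH = insert.IH[OF _ insert.prems(2)]
  show ?case
  proof (cases k)
    case 0
    then show ?thesis
      using insert.hyps insert.prems D IH[of 0] by (simp add: bern_weight_insert_0 q)
  next
    case (Suc m)
    let ?t = "\<lambda>j. p j * r / (1 - p j + p j * r)"
    have "bern_weight (insert j I) p k * r ^ k =
        (1 - p j) * (bern_weight I p (Suc m) * r ^ Suc m) + p j * r * (bern_weight I p m * r ^ m)"
      using insert.hyps Suc by (simp add: bern_weight_insert_Suc algebra_simps)
    also have "\<dots> = (\<Prod>j\<in>I. 1 - p j + p j * r) *
        ((1 - p j) * bern_weight I ?t (Suc m) + p j * r * bern_weight I ?t m)"
      using insert.prems IH by (simp add: algebra_simps del: power_Suc)
    also have "(1 - p j) * bern_weight I ?t (Suc m) + p j * r * bern_weight I ?t m =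
        ?D * bern_weight (insert j I) ?t k"
      using insert.hyps D Suc by (simp add: bern_weight_insert_Suc q distrib_left)
    finally show ?thesis using insert.hyps by simp
  qed
qed

text \<open>Stirling's bound turns the tilting factor r^(-k) at r = k / \<lambda> into a Poisson
  weight; \<open>exp 1\<close> is rounded up to 3.\<close>

lemma inverse_power_le_pois:
  assumes l: "0 < l" and k: "k \<ge> 1"
  shows "1 / (real k / l) ^ k \<le> 3 * sqrt (real k) * pois l k * exp (l - real k)"
proof -
  have k0: "0 < real k" using k by simp
  have "fact k \<le> 3 * sqrt (real k) * (real k / exp 1) ^ k"
    using fact_le_stirling[OF k] exp_le
    by (elim order_trans) (intro mult_right_mono, auto)
  also have "(real k / exp 1) ^ k = real k ^ k * exp (- real k)"
    using exp_of_nat_mult[of k "1::real"] by (simp add: exp_minus divide_inverse power_mult_distrib power_inverse)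
  finally have f: "fact k \<le> 3 * sqrt (real k) * (real k ^ k * exp (- real k))" .
  have "1 / (real k / l) ^ k = (l ^ k / real k ^ k / fact k) * fact k"
    by (simp add: power_divide)
  also have "\<dots> \<le> (l ^ k / real k ^ k / fact k) * (3 * sqrt (real k) * (real k ^ k * exp (- real k)))"
    using f l by (intro mult_left_mono) auto
  also have "\<dots> = 3 * sqrt (real k) * (l ^ k / fact k) * exp (- real k)"
    using k0 by simp
  also have "\<dots> = 3 * sqrt (real k) * pois l k * exp (l - real k)"
    by (simp add: pois_def exp_diff exp_minus field_simps)
  finally show ?thesis .
qed

text \<open>A gain of exp(-u/8) over 1 + u <= exp u away from the origin, for summands whose tilted
  odds are large.\<close>

lemma one_plus_le_exp_linear:
  assumes "1 / 2 \<le> (u::real)"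
  shows "1 + u \<le> exp (7 / 8 * u)"
proof -
  have "1 / 8 * u \<le> (7 / 8 * u)\<^sup>2 / 2"
  proof -
    have "1 / 2 * u \<le> u * u" using assms by (intro mult_right_mono) auto
    then show ?thesis using assms by (simp add: power2_eq_square)
  qed
  then have "1 + u \<le> 1 + 7 / 8 * u + (7 / 8 * u)\<^sup>2 / 2" by simp
  also have "\<dots> \<le> exp (7 / 8 * u)" using assms by (intro exp_lower_Taylor_quadratic) auto
  finally show ?thesis .
qed

text \<open>For k >= 1 and \<lambda> > 1, tilting gives the ratio bound
  \<open>3 * sqrt (real k) * b * Q\<close> with a tilted weight \<open>b\<close> and
  \<open>Q\<close> <= 1. The factor sqrt k is offset by \<open>b\<close> if the tilted variance is
  large, and by \<open>Q\<close> otherwise. The case \<lambda> <= 1 is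
  \<open>bern_weight_le\<close>; k = 0 is direct.\<close>

lemma bern_weight_le_pois:
  assumes I: "finite I" and p: "\<forall>j\<in>I. 0 \<le> p j \<and> p j \<le> 1"
    and l: "l = sum p I" and s: "s = (\<Sum>j\<in>I. p j * (1 - p j))"
  shows "bern_weight I p k \<le> 96 * sqrt (max 1 l / max 1 s) * pois l k"
proof -
  have sl: "s \<le> l" unfolding s l using p by (intro sum_mono) (auto simp: mult_left_le)
  have F: "1 \<le> sqrt (max 1 l / max 1 s)"
    using sl by (auto simp: max_def)
  have l0: "0 \<le> l" unfolding l using p by (intro sum_nonneg) auto
  then have v: "0 \<le> pois l k" by (simp add: pois_def)
  consider "l \<le> 1" | "k = 0" | "1 < l" "k \<ge> 1" by linarith
  then show ?thesis
  proof cases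
    case 1
    have "bern_weight I p k \<le> l ^ k / fact k" using bern_weight_le[OF I p] l by simp
    also have "\<dots> = exp l * pois l k" by (simp add: pois_def exp_minus)
    also have "\<dots> \<le> 96 * sqrt (max 1 l / max 1 s) * pois l k"
    proof (rule mult_right_mono)
      have "exp l \<le> 3" using 1 exp_le by (meson exp_le_cancel_iff order_trans)
      then show "exp l \<le> 96 * sqrt (max 1 l / max 1 s)" using F by linarith
    qed (use v in simp)
    finally show ?thesis .
  next
    case 2
    have "bern_weight I p 0 = (\<Prod>j\<in>I. 1 - p j)"
      using I by (induction I rule: finite_induct) (simp_all add: bern_weight_empty bern_weight_insert_0)
    also have "\<dots> \<le> (\<Prod>j\<in>I. exp (- p j))"
    proof (rule prod_mono)
      fix j assume "j \<in> I"
      then show "0 \<le> 1 - p j \<and> 1 - p j \<le> exp (- p j)"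
        using p exp_ge_add_one_self[of "- p j"] by auto
    qed
    also have "\<dots> = 1 * pois l k"
      using I 2 by (simp add: l pois_def exp_sum [symmetric] sum_negf)
    also have "\<dots> \<le> 96 * sqrt (max 1 l / max 1 s) * pois l k"
      using v F by (intro mult_right_mono) linarith+
    finally show ?thesis using 2 by simp
  next
    case 3
    \<comment> \<open>The tilt that carries the Poisson law with parameter \<open>l\<close> to the
      one with mean \<open>k\<close>.\<close>
    define r where "r = real k / l"
    define D where "D j = 1 - p j + p j * r" for j
    define t where "t j = p j * r / D j" for j
    define sr where "sr = (\<Sum>j\<in>I. t j * (1 - t j))"
    \<comment> \<open>\<open>Q\<close> merges the product of the normalizers \<open>D j\<close> with
      the factor exp(\<lambda> - k) left by Stirling's bound.\<close>
    define Q where "Q = (\<Prod>j\<in>I. D j * exp (- (p j * (r - 1))))"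
    define b where "b = bern_weight I t k"
    have l2: "0 < l" using 3 by simp
    have r: "0 < r" and k: "real k = r * l" using 3 by (auto simp: r_def)
    have D: "0 < D j" if "j \<in> I" for j
    proof (cases "p j = 0")
      case False
      then have "0 < p j * r" using p r that by (simp add: less_le)
      then show ?thesis using p that by (simp add: D_def add_nonneg_pos)
    qed (simp add: D_def)
    have tt: "t j * (1 - t j) = p j * (1 - p j) * (r / (D j)\<^sup>2)" if "j \<in> I" for j
    proof -
      have "1 - t j = (1 - p j) / D j" using D[OF that] by (simp add: t_def D_def field_simps)
      then show ?thesis by (simp add: t_def power2_eq_square)
    qed
    have t01: "\<forall>j\<in>I. 0 \<le> t j \<and> t j \<le> 1"
      using p r D by (auto simp: t_def D_def)
    have b: "0 \<le> b" "b \<le> 1"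
      unfolding b_def using I t01 by (auto intro: bern_weight_nonneg bern_weight_le_1)
    have b_le: "b \<le> 2 / sqrt L" if "0 < L" "L \<le> sr" for L
    proof -
      have "b \<le> 2 / sqrt sr"
        unfolding b_def using I t01 sr_def that by (intro bern_weight_le_inverse_sd) auto
      also have "\<dots> \<le> 2 / sqrt L" using that by (intro divide_left_mono) auto
      finally show ?thesis .
    qed
    have Dexp: "D j * exp (- (p j * (r - 1))) \<le> 1" for j
    proof -
      define x where "x = p j * (r - 1)"
      have "D j = 1 + x" by (simp add: D_def x_def algebra_simps)
      then have "D j * exp (- x) \<le> exp x * exp (- x)"
        using exp_ge_add_one_self[of x] by (intro mult_right_mono) auto
      then show ?thesis by (simp add: exp_minus_inverse x_def)
    qed
    have Q: "0 \<le> Q" "Q \<le> 1"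
      unfolding Q_def using D Dexp by (auto intro!: prod_nonneg prod_le_1 simp: less_imp_le)
    have "l - real k = (\<Sum>j\<in>I. - (p j * (r - 1)))"
      by (simp only: sum_negf sum_distrib_right [symmetric] l [symmetric]) (simp add: k algebra_simps)
    then have Q_eq: "(\<Prod>j\<in>I. D j) * exp (l - real k) = Q"
      by (simp only: Q_def prod.distrib exp_sum[OF I])
    have "bern_weight I p k * r ^ k = (\<Prod>j\<in>I. D j) * b"
      using bern_weight_tilt[OF I p r, of k] unfolding b_def t_def [abs_def] D_def .
    then have "bern_weight I p k = (\<Prod>j\<in>I. D j) * b * (1 / r ^ k)"
      using r by (simp add: eq_divide_eq)
    also have "\<dots> \<le> (\<Prod>j\<in>I. D j) * b * (3 * sqrt (real k) * pois l k * exp (l - real k))"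
      unfolding r_def using inverse_power_le_pois[OF l2 3(2)] D b
      by (intro mult_left_mono mult_nonneg_nonneg prod_nonneg) (auto simp: less_imp_le)
    also have "\<dots> = 3 * sqrt (real k) * b * Q * pois l k"
      unfolding Q_eq [symmetric] by (simp only: mult_ac)
    also have "\<dots> \<le> 96 * sqrt (max 1 l / max 1 s) * pois l k"
    proof (rule mult_right_mono)
      have le: "3 * sqrt (real k) * b * Q \<le> 3 * sqrt (real k) * b"
        using Q b by (intro mult_left_le) auto
      \<comment> \<open>For r <= 2 and s <= 1 the bounds b <= 1 and k <= 4 \<lambda> suffice. For r
        <= 2 and s > 1 all \<open>D j\<close> <= 2, so the tilted variance is at least
        \<open>r * s / 4\<close>. For r > 2 the bound is an absolute constant.\<close>
      consider "r \<le> 2" "s \<le> 1" | "r \<le> 2" "1 < s" | "2 < r" by linarith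
      then show "3 * sqrt (real k) * b * Q \<le> 96 * sqrt (max 1 l / max 1 s)"
      proof cases
        case 1
        note le
        also have "3 * sqrt (real k) * b \<le> 3 * sqrt (real k)"
          using b by (intro mult_left_le) auto
        also have "sqrt (real k) \<le> sqrt (4 * l)"
          unfolding k using 1 l0 by (intro real_sqrt_le_mono mult_right_mono) auto
        finally have "3 * sqrt (real k) * b * Q \<le> 6 * sqrt l"
          by (simp add: real_sqrt_mult)
        also have "\<dots> \<le> 96 * sqrt l" using l0 by (intro mult_right_mono) auto
        finally show ?thesis using 1 \<open>1 < l\<close> by simp
      next
        case 2
        have "r * s / 4 = (\<Sum>j\<in>I. p j * (1 - p j) * (r / 2\<^sup>2))"
          unfolding s sum_distrib_right [symmetric] by (simp add: mult.commute)
        also have "\<dots> \<le> sr"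
          unfolding sr_def
        proof (rule sum_mono)
          fix j assume j: "j \<in> I"
          have "p j * r \<le> p j * 2" using p j 2 by (intro mult_left_mono) auto
          then have D2: "D j \<le> 2" using p j by (auto simp: D_def)
          have "p j * (1 - p j) * (r / 2\<^sup>2) \<le> p j * (1 - p j) * (r / (D j)\<^sup>2)"
            using p j r D[OF j] D2
            by (intro mult_left_mono divide_left_mono power_mono mult_pos_pos) auto
          then show "p j * (1 - p j) * (r / 2\<^sup>2) \<le> t j * (1 - t j)" by (simp add: tt[OF j])
        qed
        finally have "b \<le> 2 / sqrt (r * s / 4)" using r 2 by (intro b_le) auto
        then have "3 * sqrt (real k) * b \<le> 3 * sqrt (real k) * (2 / sqrt (r * s / 4))"
          by (intro mult_left_mono) auto
        also have "\<dots> = 12 * sqrt (l / s)"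
          unfolding k using r 2 by (simp add: real_sqrt_mult real_sqrt_divide)
        also have "\<dots> \<le> 96 * sqrt (l / s)" using l0 2 by (intro mult_right_mono) auto
        finally have "3 * sqrt (real k) * b * Q \<le> 96 * sqrt (l / s)" by (rule order_trans[OF le])
        moreover have "max 1 l = l" "max 1 s = s" using 2 \<open>1 < l\<close> by auto
        ultimately show ?thesis by simp
      next
        case 3
        \<comment> \<open>If the summands with small \<open>p j * r\<close> carry half of
          \<open>l\<close>, they alone give tilted variance at least k/16. Otherwise the other
          summands satisfy p_j (r - 1) >= 1/2, each gains a factor exp(-p_j (r - 1)/8), and
          \<open>Q\<close> <= exp(-k/32).\<close>
        define A where "A = {j \<in> I. p j * r \<le> 1}"
        have A: "finite A" "A \<subseteq> I" using I by (auto simp: A_def)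
        have "3 * sqrt (real k) * b * Q \<le> 96"
        proof (cases "l / 2 \<le> sum p A")
          case True
          have "r * l / 16 \<le> (\<Sum>j\<in>A. p j * (r / 8))"
            unfolding sum_distrib_right [symmetric] using True r
            by (simp add: field_simps)
          also have "\<dots> \<le> (\<Sum>j\<in>A. t j * (1 - t j))"
          proof (rule sum_mono)
            fix j assume "j \<in> A"
            then have j: "j \<in> I" "p j * r \<le> 1" by (auto simp: A_def)
            have "p j * 2 \<le> p j * r" using p j 3 by (intro mult_left_mono) auto
            then have p2: "p j \<le> 1 / 2" using j by simp
            have D2: "D j \<le> 2" using p j by (auto simp: D_def)
            have "p j * (1 / 2) * (r / 2\<^sup>2) \<le> p j * (1 - p j) * (r / (D j)\<^sup>2)"
              using p j r D[OF j(1)] D2 p2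
              by (intro mult_mono divide_left_mono power_mono mult_pos_pos) auto
            then show "p j * (r / 8) \<le> t j * (1 - t j)" by (simp add: tt[OF j(1)])
          qed
          also have "\<dots> \<le> sr"
            unfolding sr_def using A I t01 by (intro sum_mono2) auto
          finally have "b \<le> 2 / sqrt (r * l / 16)" using r l2 by (intro b_le) auto
          then have "3 * sqrt (real k) * b \<le> 3 * sqrt (real k) * (2 / sqrt (r * l / 16))"
            by (intro mult_left_mono) auto
          also have "\<dots> = 24"
            unfolding k using r l2 by (simp add: real_sqrt_divide)
          finally show ?thesis using le by linarith
        next
          case False
          have "sum p (I - A) = l - sum p A"
            using I A by (simp add: l sum_diff)
          then have half: "l / 2 \<le> sum p (I - A)" using False by simp
          have "Q \<le> (\<Prod>j\<in>I. exp (- (if j \<in> A then 0 else p j * (r - 1) / 8)))"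
            unfolding Q_def
          proof (rule prod_mono)
            fix j assume j: "j \<in> I"
            have "D j * exp (- (p j * (r - 1))) \<le> exp (- (p j * (r - 1) / 8))" if "j \<notin> A"
            proof -
              have "1 < p j * r" using that j by (auto simp: A_def)
              moreover have "p j * (r / 2) \<le> p j * (r - 1)"
                using 3 p j by (intro mult_left_mono) auto
              ultimately have "1 / 2 \<le> p j * (r - 1)" by simp
              then have "1 + p j * (r - 1) \<le> exp (7 / 8 * (p j * (r - 1)))"
                by (rule one_plus_le_exp_linear)
              then have "D j * exp (- (p j * (r - 1))) \<le>
                  exp (7 / 8 * (p j * (r - 1))) * exp (- (p j * (r - 1)))"
                by (intro mult_right_mono) (auto simp: D_def algebra_simps)
              also have "\<dots> = exp (- (p j * (r - 1) / 8))"
                by (simp add: exp_add [symmetric])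
              finally show ?thesis .
            qed
            then show "0 \<le> D j * exp (- (p j * (r - 1))) \<and>
                D j * exp (- (p j * (r - 1))) \<le> exp (- (if j \<in> A then 0 else p j * (r - 1) / 8))"
              using D[OF j] Dexp by (auto simp: less_imp_le)
          qed
          also have "\<dots> = exp (- (\<Sum>j\<in>I. if j \<in> A then 0 else p j * (r - 1) / 8))"
            using I by (simp add: exp_sum [symmetric] sum_negf)
          also have "(\<Sum>j\<in>I. if j \<in> A then 0 else p j * (r - 1) / 8) =
              (\<Sum>j\<in>I - A. p j * (r - 1) / 8)"
            using I by (intro sum.mono_neutral_cong_right) auto
          also have "\<dots> = sum p (I - A) * ((r - 1) / 8)"
            by (simp add: sum_distrib_right)
          also have "exp (- (sum p (I - A) * ((r - 1) / 8))) \<le> exp (- (real k / 32))"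
          proof -
            have "real k / 32 = l / 2 * (r / 16)" by (simp add: k)
            also have "\<dots> \<le> sum p (I - A) * ((r - 1) / 8)"
              using half 3 l0 by (intro mult_mono) auto
            finally show ?thesis by simp
          qed
          finally have Qk: "Q \<le> exp (- (real k / 32))" .
          \<comment> \<open>The decay of \<open>Q\<close> absorbs sqrt k at the price of a factor
            32, whence 96 = 3 * 32.\<close>
          have "sqrt (real k) \<le> real k"
            using \<open>k \<ge> 1\<close> by (intro real_le_lsqrt) (auto simp: power2_eq_square)
          also have "\<dots> \<le> 32 * exp (real k / 32)"
            using exp_ge_add_one_self[of "real k / 32"] by linarith
          finally have sk: "sqrt (real k) \<le> 32 * exp (real k / 32)" .
          have "3 * sqrt (real k) * b * Q \<le> 3 * (32 * exp (real k / 32)) * 1 * exp (- (real k / 32))"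
            using sk b Q Qk by (intro mult_mono) auto
          also have "\<dots> = 96" by (simp add: exp_minus)
          finally show ?thesis .
        qed
        then show ?thesis using F by linarith
      qed
    qed (use v in simp)
    finally show ?thesis .
  qed
qed

section \<open>Upper bound for the chi-square distance\<close>

text \<open>Expanding the square and using that both masses are 1 reduces the series to a finite
  sum, the form in which the distance is bounded below.\<close>

lemma chi_square_sums:
  assumes I: "finite I" and l: "0 < l"
  shows "(\<lambda>k. (bern_weight I p k - pois l k)\<^sup>2 / pois l k) sums
    ((\<Sum>k\<le>card I. (bern_weight I p k)\<^sup>2 / pois l k) - 1)"
proof -
  have "(\<lambda>k. (bern_weight I p k)\<^sup>2 / pois l k) sums (\<Sum>k\<le>card I. (bern_weight I p k)\<^sup>2 / pois l k)"
    using I by (intro sums_finite) (auto simp: bern_weight_eq_0)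
  moreover have "bern_weight I p sums (\<Sum>k\<le>card I. bern_weight I p k)"
    using I by (intro sums_finite) (auto simp: bern_weight_eq_0)
  then have "bern_weight I p sums 1" using I by (simp add: sum_bern_weight)
  ultimately have "(\<lambda>k. (bern_weight I p k)\<^sup>2 / pois l k - 2 * bern_weight I p k + pois l k) sums
      ((\<Sum>k\<le>card I. (bern_weight I p k)\<^sup>2 / pois l k) - 2 * 1 + 1)"
    by (intro sums_add sums_diff sums_mult pois_sums)
  moreover have "(bern_weight I p k - pois l k)\<^sup>2 / pois l k =
      (bern_weight I p k)\<^sup>2 / pois l k - 2 * bern_weight I p k + pois l k" for k
    using pois_pos[OF l, of k] by (simp add: power2_eq_square field_simps)
  ultimately show ?thesis by simp
qed

text \<open>\<open>T\<close> is P(Z > n). For k >= n the recursion gives (n - \<lambda>) v_(k+1) <=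
  \<lambda> v_k - \<lambda> v_(k+1), which telescopes. The bound controls the boundary terms of
  \<open>stein_energy\<close>.\<close>

lemma pois_tail:
  fixes l :: real and n :: nat
  assumes l: "0 < l"
  defines "T \<equiv> 1 - (\<Sum>k\<le>n. pois l k)"
  shows "0 \<le> T" "(real n - l) * T \<le> l * pois l n"
proof -
  have T: "(\<lambda>k. pois l (k + Suc n)) sums T"
    using sums_split_initial_segment[OF pois_sums[of l], of "Suc n"]
    by (simp add: T_def lessThan_Suc_atMost)
  then show "0 \<le> T"
    using pois_pos[OF l] by (intro sums_le[OF _ sums_zero T]) (auto intro: less_imp_le)
  have "(\<lambda>k. l * pois l (k + n)) \<longlonglongrightarrow> l * 0"
    using pois_sums[of l]
    by (intro tendsto_mult tendsto_const LIMSEQ_ignore_initial_segment summable_LIMSEQ_zero)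
      (rule sums_summable)
  then have "(\<lambda>k. l * pois l (k + n) - l * pois l (Suc k + n)) sums (l * pois l (0 + n) - l * 0)"
    by (rule telescope_sums')
  then have S: "(\<lambda>k. l * pois l (k + n) - l * pois l (Suc k + n)) sums (l * pois l n)" by simp
  show "(real n - l) * T \<le> l * pois l n"
  proof (rule sums_le[OF _ sums_mult[OF T] S])
    fix k
    have "l * pois l (k + n) = real (Suc (k + n)) * pois l (Suc (k + n))" by (rule pois_Suc [symmetric])
    moreover have "real n * pois l (Suc (k + n)) \<le> real (Suc (k + n)) * pois l (Suc (k + n))"
      using pois_pos[OF l, of "Suc (k + n)"] by (intro mult_right_mono) auto
    ultimately show "(real n - l) * pois l (k + Suc n) \<le> l * pois l (k + n) - l * pois l (Suc k + n)"
      by (simp add: algebra_simps)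
  qed
qed

text \<open>With \<open>G k = g (k + 1)\<close> the summand on the left is the square of the Stein operator
  \<open>l * g (k + 1) - k * g k\<close>; the last two terms on the right are boundary terms.\<close>

lemma stein_energy:
  "(\<Sum>k\<le>N. pois l k * (l * G k - real k * G (k - 1))\<^sup>2) =
    l\<^sup>2 * (\<Sum>k<N. pois l k * (G (Suc k) - G k)\<^sup>2) + l * (\<Sum>k<N. pois l k * (G k)\<^sup>2)
    + l\<^sup>2 * pois l N * (G N)\<^sup>2 - l * real N * pois l N * (G N)\<^sup>2"
proof (induction N)
  case 0
  show ?case by (simp add: power2_eq_square)
next
  case (Suc N)
  have v: "real (Suc N) * pois l (Suc N) = l * pois l N" by (rule pois_Suc)
  have N: "real (Suc N) = real N + 1" by simp
  have "pois l (Suc N) * (l * G (Suc N) - real (Suc N) * G (Suc N - 1))\<^sup>2 =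
      l\<^sup>2 * (pois l N * (G (Suc N) - G N)\<^sup>2) + l * (pois l N * (G N)\<^sup>2)
      + l\<^sup>2 * pois l (Suc N) * (G (Suc N))\<^sup>2 - l * real (Suc N) * pois l (Suc N) * (G (Suc N))\<^sup>2
      - l\<^sup>2 * pois l N * (G N)\<^sup>2 + l * real N * pois l N * (G N)\<^sup>2"
    unfolding diff_Suc_1 using v N by algebra
  then show ?case
    using Suc.IH unfolding sum.atMost_Suc sum.lessThan_Suc distrib_left by linarith
qed

text \<open>The Stein equation and the size-bias identity express \<open>chi\<close> through
  differences of \<open>G\<close> under the W_j. A weighted arithmetic-geometric inequality bounds
  this by half of the right side plus \<open>l\<^sup>2 * E / 2\<close>, and the latter is at most
  \<open>chi / 2\<close> and is absorbed.\<close>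

lemma chi_square_le_weights:
  assumes I: "finite I" and p: "\<forall>j\<in>I. 0 \<le> p j \<and> p j \<le> 1"
    and l: "l = sum p I" "0 < l"
    and K: "\<And>j. j \<in> I \<Longrightarrow> (\<Sum>k<card I. (bern_weight (I - {j}) p k)\<^sup>2 / pois l k) \<le> K"
  shows "(\<Sum>k\<le>card I. (bern_weight I p k)\<^sup>2 / pois l k) - 1 \<le> ((\<Sum>j\<in>I. (p j)\<^sup>2) / l)\<^sup>2 * K"
proof -
  define n where "n = card I"
  define w where "w = bern_weight I p"
  define v where "v = pois l"
  \<comment> \<open>\<open>T\<close> is the difference of the distribution functions. Dividing by
    \<open>l * v k\<close> solves the Stein equation because \<lambda> v_(k-1) = k v_k.\<close>
  define T where "T k = (\<Sum>i\<le>k. w i - v i)" for k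
  define G where "G k = T k / (l * v k)" for k
  define chi where "chi = (\<Sum>k\<le>n. (w k)\<^sup>2 / v k) - 1"
  define l2 where "l2 = (\<Sum>j\<in>I. (p j)\<^sup>2)"
  define E where "E = (\<Sum>k<n. v k * (G (Suc k) - G k)\<^sup>2)"
  have v: "0 < v k" for k using l by (simp add: v_def pois_pos)
  have sw: "(\<Sum>k\<le>n. w k) = 1" using I by (simp add: w_def n_def sum_bern_weight)
  have n: "n \<ge> 1" using l I by (cases "I = {}") (auto simp: n_def Suc_le_eq card_gt_0_iff)
  have l2: "0 < l2"
  proof -
    obtain j where "j \<in> I" "p j \<noteq> 0" using l by (metis less_irrefl sum.neutral)
    then show ?thesis unfolding l2_def using I by (intro sum_pos2[of I j]) auto
  qed
  \<comment> \<open>At k = 0 truncated subtraction makes \<open>G (k - 1)\<close> equal to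
    \<open>G 0\<close>, but its factor is 0.\<close>
  have f: "l * G k - real k * G (k - 1) = (w k - v k) / v k" for k
  proof (cases k)
    case 0
    then show ?thesis using l by (simp add: G_def T_def)
  next
    case (Suc m)
    have "real (Suc m) * G m = T m / v (Suc m)"
    proof -
      have "l * v m = real (Suc m) * v (Suc m)" unfolding v_def by (rule pois_Suc [symmetric])
      then show ?thesis by (simp add: G_def del: of_nat_Suc)
    qed
    moreover have "l * G (Suc m) = T (Suc m) / v (Suc m)" using l by (simp add: G_def)
    moreover have "T (Suc m) = T m + (w (Suc m) - v (Suc m))" by (simp add: T_def)
    ultimately show ?thesis
      unfolding Suc diff_Suc_1 by (simp only: diff_divide_distrib [symmetric]) simp
  qed
  have Tn: "T n = 1 - (\<Sum>k\<le>n. v k)" by (simp add: T_def sum_subtractf sw)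
  have chi1: "chi = (\<Sum>k\<le>n. w k * ((w k - v k) / v k))"
  proof -
    have "w k * ((w k - v k) / v k) = (w k)\<^sup>2 / v k - w k" for k
      using v[of k] by (simp add: power2_eq_square field_simps)
    then show ?thesis by (simp add: chi_def sum_subtractf sw)
  qed
  \<comment> \<open>The full series is \<open>chi\<close>; its terms beyond \<open>n\<close>, where
    \<open>w\<close> vanishes, add up to the Poisson tail \<open>T n\<close>.\<close>
  have chi2: "(\<Sum>k\<le>n. v k * ((w k - v k) / v k)\<^sup>2) = chi - T n"
  proof -
    have "v k * ((w k - v k) / v k)\<^sup>2 = (w k)\<^sup>2 / v k - 2 * w k + v k" for k
      using v[of k] by (simp add: power2_eq_square field_simps)
    then show ?thesis by (simp add: chi_def Tn sum_subtractf sum.distrib sum_distrib_left [symmetric] sw)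
  qed
  \<comment> \<open>Since \<open>T n = l * v n * G n\<close>, the boundary terms and
    \<open>T n\<close> combine to \<open>l * v n * G n * (1 - (real n - l) * G n)\<close>, which is
    nonnegative by the tail bound.\<close>
  have E_le: "l\<^sup>2 * E \<le> chi"
  proof -
    have "0 \<le> T n" and tail: "(real n - l) * T n \<le> l * v n"
      using pois_tail[OF l(2), of n] unfolding Tn v_def by auto
    then have G0: "0 \<le> G n" using l(2) v[of n] by (simp add: G_def)
    have "(real n - l) * G n = (real n - l) * T n / (l * v n)" by (simp add: G_def)
    also have "\<dots> \<le> 1" using tail l(2) v[of n] by (simp add: divide_le_eq)
    finally have Gn: "(real n - l) * G n \<le> 1" .
    have "chi - T n = l\<^sup>2 * E + l * (\<Sum>k<n. v k * (G k)\<^sup>2)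
        + l\<^sup>2 * v n * (G n)\<^sup>2 - l * real n * v n * (G n)\<^sup>2"
      using stein_energy[where l = l and G = G and N = n] unfolding v_def [symmetric] f chi2 E_def .
    moreover have "0 \<le> l * (\<Sum>k<n. v k * (G k)\<^sup>2)"
      using l(2) v by (intro mult_nonneg_nonneg sum_nonneg) (auto intro: less_imp_le)
    moreover have "T n = l * v n * G n" using l(2) v[of n] by (simp add: G_def)
    moreover have "0 \<le> l * v n * G n * (1 - (real n - l) * G n)"
      using l(2) v[of n] G0 Gn by (intro mult_nonneg_nonneg) auto
    ultimately show ?thesis by (simp add: power2_eq_square algebra_simps)
  qed
  have exp1: "bern_exp (I - {j}) p g = (\<Sum>k<n. bern_weight (I - {j}) p k * g k)" if "j \<in> I" for j g
  proof -
    have "{..card (I - {j})} = {..<n}" using that I n by (auto simp: n_def)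
    then show ?thesis by (simp only: bern_exp_def)
  qed
  have "chi = (\<Sum>k\<le>n. l * (w k * G k) - real k * w k * G (k - 1))"
    unfolding chi1 f [symmetric] by (intro sum.cong) (auto simp: algebra_simps)
  also have "\<dots> = l * bern_exp I p G - (\<Sum>k\<le>n. real k * w k * G (k - 1))"
    by (simp add: sum_subtractf sum_distrib_left [symmetric] bern_exp_def w_def n_def)
  also have "(\<Sum>k\<le>n. real k * w k * G (k - 1)) = (\<Sum>k<n. real (Suc k) * w (Suc k) * G k)"
    using n by (cases n) (simp_all add: sum.atMost_Suc_shift lessThan_Suc_atMost del: sum.atMost_Suc of_nat_Suc)
  also have "\<dots> = (\<Sum>k<n. \<Sum>j\<in>I. p j * (bern_weight (I - {j}) p k * G k))"
    using Suc_mult_bern_weight[OF I, of _ p]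
    by (simp add: w_def sum_distrib_right mult.assoc del: of_nat_Suc)
  also have "\<dots> = (\<Sum>j\<in>I. p j * bern_exp (I - {j}) p G)"
    by (subst sum.swap) (auto simp: exp1 sum_distrib_left intro!: sum.cong)
  also have "l * bern_exp I p G = (\<Sum>j\<in>I. p j * bern_exp I p G)"
    by (simp add: l sum_distrib_right)
  also have "(\<Sum>j\<in>I. p j * bern_exp I p G) - (\<Sum>j\<in>I. p j * bern_exp (I - {j}) p G) =
      (\<Sum>j\<in>I. (p j)\<^sup>2 * (\<Sum>k<n. bern_weight (I - {j}) p k * (G (Suc k) - G k)))"
    unfolding sum_subtractf [symmetric]
  proof (rule sum.cong[OF refl])
    fix j assume j: "j \<in> I"
    have "bern_exp I p G = (1 - p j) * bern_exp (I - {j}) p G + p j * bern_exp (I - {j}) p (\<lambda>k. G (Suc k))"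
      using bern_exp_insert[of "I - {j}" j p G] I j by (simp add: insert_absorb)
    then have "p j * bern_exp I p G - p j * bern_exp (I - {j}) p G =
        (p j)\<^sup>2 * (bern_exp (I - {j}) p (\<lambda>k. G (Suc k)) - bern_exp (I - {j}) p G)"
      by algebra
    then show "p j * bern_exp I p G - p j * bern_exp (I - {j}) p G =
        (p j)\<^sup>2 * (\<Sum>k<n. bern_weight (I - {j}) p k * (G (Suc k) - G k))"
      by (simp add: exp1[OF j] sum_subtractf right_diff_distrib)
  qed
  also have "\<dots> \<le> (\<Sum>j\<in>I. (p j)\<^sup>2 * (l2 / (2 * l\<^sup>2) * K + l\<^sup>2 / (2 * l2) * E))"
  proof (intro sum_mono mult_left_mono)
    fix j assume j: "j \<in> I"
    define u where "u = bern_weight (I - {j}) p"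
    \<comment> \<open>Chosen so that summation against p_j^2, of total \<open>l2\<close>, leaves the
      energy with coefficient exactly \<open>l\<^sup>2 / 2\<close>.\<close>
    define c where "c = l\<^sup>2 / l2"
    have c: "0 < c" using l l2 by (simp add: c_def)
    have "(\<Sum>k<n. u k * (G (Suc k) - G k)) \<le>
        (\<Sum>k<n. 1 / (2 * c) * ((u k)\<^sup>2 / v k) + c / 2 * (v k * (G (Suc k) - G k)\<^sup>2))"
    proof (rule sum_mono)
      fix k
      have am: "x * y \<le> 1 / (2 * c) * (x\<^sup>2 / z) + c / 2 * (z * y\<^sup>2)" if "0 < z" for x y z :: real
      proof -
        have "0 \<le> (x - c * z * y)\<^sup>2 / (2 * c * z)" using that c by simp
        also have "\<dots> = 1 / (2 * c) * (x\<^sup>2 / z) + c / 2 * (z * y\<^sup>2) - x * y"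
          using that c by (simp add: power2_eq_square field_simps)
        finally show ?thesis by simp
      qed
      show "u k * (G (Suc k) - G k) \<le> 1 / (2 * c) * ((u k)\<^sup>2 / v k) + c / 2 * (v k * (G (Suc k) - G k)\<^sup>2)"
        by (rule am[OF v])
    qed
    also have "\<dots> = 1 / (2 * c) * (\<Sum>k<n. (u k)\<^sup>2 / v k) + c / 2 * E"
      by (simp only: sum.distrib sum_distrib_left E_def)
    also have "\<dots> \<le> 1 / (2 * c) * K + c / 2 * E"
      using K[OF j] c by (intro add_right_mono mult_left_mono) (auto simp: u_def v_def n_def)
    also have "\<dots> = l2 / (2 * l\<^sup>2) * K + l\<^sup>2 / (2 * l2) * E"
      by (simp add: c_def)
    finally show "(\<Sum>k<n. bern_weight (I - {j}) p k * (G (Suc k) - G k)) \<le>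
        l2 / (2 * l\<^sup>2) * K + l\<^sup>2 / (2 * l2) * E" by (simp add: u_def)
  qed simp
  also have "\<dots> = l2 * (l2 / (2 * l\<^sup>2) * K + l\<^sup>2 / (2 * l2) * E)"
    by (simp only: l2_def sum_distrib_right)
  also have "\<dots> = (l2 / l)\<^sup>2 * K / 2 + l\<^sup>2 * E / 2"
    using l2 l(2) by (simp add: power2_eq_square distrib_left)
  finally have "chi \<le> (l2 / l)\<^sup>2 * K" using E_le by linarith
  then show ?thesis by (simp add: chi_def l2_def w_def v_def n_def)
qed

lemma pois_diff_le:
  assumes "0 \<le> q" "q \<le> 1" "q \<le> l"
  shows "pois (l - q) k \<le> 3 * pois l k"
proof -
  have "pois (l - q) k = (l - q) ^ k / fact k * exp (- l) * exp q"
    by (simp add: pois_def exp_add [symmetric])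
  also have "\<dots> \<le> l ^ k / fact k * exp (- l) * 3"
  proof (intro mult_mono divide_right_mono power_mono)
    show "exp q \<le> 3" using assms exp_le by (meson exp_le_cancel_iff order_trans)
  qed (use assms in auto)
  finally show ?thesis by (simp add: pois_def mult_ac)
qed

text \<open>A bound u_k <= C v_k gives sum u_k^2 / v_k <= C because \<open>u\<close> has mass 1.
  Here 576 = 96 * 2 * 3: the ratio bound, the change of F and the change of the Poisson
  parameter.\<close>

lemma chi_square_le:
  assumes I: "finite I" and p: "\<forall>j\<in>I. 0 \<le> p j \<and> p j \<le> 1"
    and l: "l = sum p I" "0 < l" and s: "s = (\<Sum>j\<in>I. p j * (1 - p j))"
  shows "(\<Sum>k\<le>card I. (bern_weight I p k)\<^sup>2 / pois l k) - 1 \<le>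
    ((\<Sum>j\<in>I. (p j)\<^sup>2) / l)\<^sup>2 * (576 * sqrt (max 1 l / max 1 s))"
proof (rule chi_square_le_weights[OF I p l])
  fix j assume j: "j \<in> I"
  define u where "u = bern_weight (I - {j}) p"
  define F where "F = max 1 l / max 1 s"
  have F0: "0 \<le> F" by (simp add: F_def)
  have p': "\<forall>i\<in>I - {j}. 0 \<le> p i \<and> p i \<le> 1" using p by auto
  have pj: "0 \<le> p j" "p j \<le> 1" "p j \<le> l"
    using p j I unfolding l by (auto intro: member_le_sum)
  have u: "u k \<le> 576 * sqrt F * pois l k" for k
  proof -
    have "u k \<le> 96 * sqrt (max 1 (l - p j) / max 1 (s - p j * (1 - p j))) * pois (l - p j) k"
      unfolding u_def using I p' j
      by (intro bern_weight_le_pois) (auto simp: l s sum_diff1)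
    also have "\<dots> \<le> 96 * (2 * sqrt F) * (3 * pois l k)"
    proof (intro mult_mono)
      \<comment> \<open>Dropping a summand lowers the variance by at most 1, so
        \<open>max 1 s\<close> is at most halved; the factor 2 is rounded up to the square
        4.\<close>
      have "p j * (1 - p j) \<le> 1 * 1" using pj by (intro mult_mono) auto
      then have "max 1 s \<le> 2 * max 1 (s - p j * (1 - p j))" by (auto simp: max_def)
      then have "max 1 l / (2 * max 1 (s - p j * (1 - p j))) \<le> F"
        unfolding F_def by (intro divide_left_mono) auto
      moreover have "max 1 (l - p j) / max 1 (s - p j * (1 - p j)) \<le>
          max 1 l / max 1 (s - p j * (1 - p j))"
        using pj by (intro divide_right_mono) auto
      ultimately have "max 1 (l - p j) / max 1 (s - p j * (1 - p j)) \<le> 2 * F" by simp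
      also have "\<dots> \<le> 2\<^sup>2 * F" using F0 by simp
      finally have "sqrt (max 1 (l - p j) / max 1 (s - p j * (1 - p j))) \<le> sqrt (2\<^sup>2 * F)"
        by (rule real_sqrt_le_mono)
      then show "sqrt (max 1 (l - p j) / max 1 (s - p j * (1 - p j))) \<le> 2 * sqrt F"
        by (simp add: real_sqrt_mult)
      show "pois (l - p j) k \<le> 3 * pois l k" using pj by (intro pois_diff_le)
    qed (use pj in \<open>auto simp: F_def pois_def\<close>)
    finally show ?thesis by simp
  qed
  have u0: "0 \<le> u k" for k unfolding u_def using I p' by (intro bern_weight_nonneg) auto
  have "(\<Sum>k<card I. (u k)\<^sup>2 / pois l k) \<le> (\<Sum>k<card I. u k * (576 * sqrt F))"
  proof (rule sum_mono)
    fix k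
    have "u k * u k \<le> u k * (576 * sqrt F * pois l k)" using u u0 by (intro mult_left_mono) auto
    then show "(u k)\<^sup>2 / pois l k \<le> u k * (576 * sqrt F)"
      using pois_pos[OF l(2), of k] by (simp add: power2_eq_square divide_le_eq mult.assoc)
  qed
  also have "\<dots> = (\<Sum>k\<le>card (I - {j}). u k) * (576 * sqrt F)"
  proof -
    have "0 < card I" using j I by (auto simp: card_gt_0_iff)
    then have "{..card (I - {j})} = {..<card I}" using j I by auto
    then show ?thesis by (simp only: sum_distrib_right)
  qed
  also have "\<dots> = 576 * sqrt F" using I by (simp add: u_def sum_bern_weight)
  finally show "(\<Sum>k<card I. (bern_weight (I - {j}) p k)\<^sup>2 / pois l k) \<le> 576 * sqrt (max 1 l / max 1 s)"
    by (simp add: u_def F_def)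
qed

section \<open>Relative entropy and lower bounds\<close>

text \<open>Applies ln x <= x - 1 to the ratio of the square roots. After summation the terms
  \<open>- w + v\<close> cancel and D dominates the squared Hellinger distance.\<close>

lemma rel_entropy_term_ge_hellinger:
  assumes "0 \<le> w" "0 < (v::real)"
  shows "(sqrt w - sqrt v)\<^sup>2 \<le> w * ln (w / v) - w + v"
proof (cases "w = 0")
  case False
  define a b where "a = sqrt w" and "b = sqrt v"
  have ab: "0 < a" "0 < b" "w = a\<^sup>2" "v = b\<^sup>2" using assms False by (auto simp: a_def b_def)
  have "ln (b / a) \<le> b / a - 1" using ab by (intro ln_le_minus_one) auto
  then have "2 * a\<^sup>2 * ln (b / a) \<le> 2 * a\<^sup>2 * (b / a - 1)" by (intro mult_left_mono) auto
  also have "\<dots> = 2 * a * b - 2 * a\<^sup>2" using ab by (simp add: power2_eq_square field_simps)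
  finally have "2 * a\<^sup>2 * ln (b / a) \<le> 2 * a * b - 2 * a\<^sup>2" .
  moreover have "w * ln (w / v) = - (2 * a\<^sup>2 * ln (b / a))"
    using ab by (simp add: ln_div ln_realpow algebra_simps)
  ultimately show ?thesis
    using ab by (simp add: a_def [symmetric] b_def [symmetric] power2_diff)
qed (use assms in auto)

text \<open>A linearized Cauchy-Schwarz inequality based on w - v = (a - b)(a + b), with
  \<open>s\<close> left free. The second square in the proof cancels the mixed term a b.\<close>

lemma rel_entropy_term_ge_test:
  assumes "0 \<le> w" "0 < (v::real)"
  shows "- (2 * s * (f * w)) + 2 * s * (f * v) - 2 * s\<^sup>2 * (f\<^sup>2 * w) - 2 * s\<^sup>2 * (f\<^sup>2 * v) \<le> w * ln (w / v) - w + v"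
proof -
  define a b where "a = sqrt w" and "b = sqrt v"
  have ab: "w = a\<^sup>2" "v = b\<^sup>2" using assms by (auto simp: a_def b_def)
  have "0 \<le> ((a - b) + s * f * (a + b))\<^sup>2 + (s * f * (a - b))\<^sup>2" by simp
  also have "\<dots> = (a - b)\<^sup>2 + 2 * s * (f * w) - 2 * s * (f * v) + 2 * s\<^sup>2 * (f\<^sup>2 * w) + 2 * s\<^sup>2 * (f\<^sup>2 * v)"
    unfolding ab by algebra
  finally show ?thesis
    using rel_entropy_term_ge_hellinger[OF assms] by (simp add: a_def b_def)
qed

text \<open>The tangent bound for w ln(w/v), with equality at w = t v; \<open>t\<close> may be
  chosen differently on different sets.\<close>

lemma rel_entropy_term_ge:
  assumes "0 \<le> w" "0 < (v::real)" "0 < t"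
  shows "w * ln t + w - t * v \<le> w * ln (w / v)"
proof (cases "w = 0")
  case False
  then have w: "0 < w" using assms by simp
  have "ln (t * v / w) \<le> t * v / w - 1" using w assms by (intro ln_le_minus_one) auto
  then have "w * ln (t * v / w) \<le> w * (t * v / w - 1)" using w by (intro mult_left_mono) auto
  moreover have "w * (t * v / w - 1) = t * v - w" using w by (simp add: field_simps)
  moreover have "ln (t * v / w) = ln t - ln (w / v)" using w assms by (simp add: ln_div ln_mult)
  ultimately show ?thesis by (simp add: algebra_simps)
qed (use assms in auto)

lemma rel_entropy_term_le:
  assumes "0 \<le> w" "0 < (v::real)" "0 < t"
  shows "w * ln (w / v) \<le> w * ln t + (w\<^sup>2 / v) / t - w"
proof (cases "w = 0")
  case False
  then have w: "0 < w" using assms by simp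
  have "ln (w / (t * v)) \<le> w / (t * v) - 1" using w assms by (intro ln_le_minus_one) auto
  then have "w * ln (w / (t * v)) \<le> w * (w / (t * v) - 1)" using w by (intro mult_left_mono) auto
  moreover have "w * (w / (t * v) - 1) = (w\<^sup>2 / v) / t - w"
    using w assms by (simp add: power2_eq_square field_simps)
  moreover have "ln (w / (t * v)) = ln (w / v) - ln t" using w assms by (simp add: ln_div ln_mult)
  ultimately have "w * (ln (w / v) - ln t) \<le> (w\<^sup>2 / v) / t - w" by simp
  then show ?thesis by (simp add: right_diff_distrib)
qed auto

lemma rel_entropy_ge_theta:
  assumes I: "finite I" and p: "\<forall>j\<in>I. 0 \<le> p j \<and> p j \<le> 1"
    and l: "l = sum p I" "0 < l"
  shows "((\<Sum>j\<in>I. (p j)\<^sup>2) / l)\<^sup>2 / 16 \<le>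
    (\<Sum>k\<le>card I. bern_weight I p k * ln (bern_weight I p k / pois l k))"
proof -
  define w where "w = bern_weight I p"
  define v where "v = pois l"
  define l2 where "l2 = (\<Sum>j\<in>I. (p j)\<^sup>2)"
  define f where "f k = (real k - l)\<^sup>2 - real k" for k
  define D where "D = (\<Sum>k\<le>card I. w k * ln (w k / v k))"
  \<comment> \<open>Maximizes \<open>2 * s * l2 - 16 * s\<^sup>2 * l\<^sup>2\<close>, where 16 = 2 *
    (6 + 2) comes from the second moments of \<open>f\<close> under the two laws.\<close>
  define s where "s = l2 / (16 * l\<^sup>2)"
  have w0: "w k = 0" if "k \<notin> {..card I}" for k
    using that I by (simp add: w_def bern_weight_eq_0)
  have W: "(\<lambda>k. g k * w k) sums bern_exp I p g" for g
    using sums_finite[of "{..card I}" "\<lambda>k. g k * w k"] w0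
    by (simp add: bern_exp_def w_def mult.commute)
  have "(\<lambda>k. w k * ln (w k / v k)) sums D"
    unfolding D_def using w0 by (intro sums_finite) auto
  then have S1: "(\<lambda>k. w k * ln (w k / v k) - w k + v k) sums (D - 1 + 1)"
    using W[of "\<lambda>_. 1"] bern_exp_1[OF I, of p] pois_sums[of l]
    by (intro sums_add sums_diff) (simp_all add: v_def)
  have fv: "(\<lambda>k. f k * v k) sums 0" "(\<lambda>k. (f k)\<^sup>2 * v k) sums (2 * l\<^sup>2)"
    using pois_charlier[of l] by (simp_all add: f_def v_def mult.commute)
  then have S2: "(\<lambda>k. - (2 * s * (f k * w k)) + 2 * s * (f k * v k) - 2 * s\<^sup>2 * ((f k)\<^sup>2 * w k) - 2 * s\<^sup>2 * ((f k)\<^sup>2 * v k))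
      sums (- (2 * s * bern_exp I p f) + 2 * s * 0 - 2 * s\<^sup>2 * bern_exp I p (\<lambda>k. (f k)\<^sup>2) - 2 * s\<^sup>2 * (2 * l\<^sup>2))"
    by (intro sums_add sums_diff sums_minus sums_mult W fv)
  have "0 \<le> w k" "0 < v k" for k
    using I p l(2) by (auto simp: w_def v_def bern_weight_nonneg pois_pos)
  then have "- (2 * s * bern_exp I p f) + 2 * s * 0 - 2 * s\<^sup>2 * bern_exp I p (\<lambda>k. (f k)\<^sup>2)
      - 2 * s\<^sup>2 * (2 * l\<^sup>2) \<le> D - 1 + 1"
    by (intro sums_le[OF _ S2 S1] rel_entropy_term_ge_test)
  moreover have "bern_exp I p f = - l2" "bern_exp I p (\<lambda>k. (f k)\<^sup>2) \<le> 6 * l\<^sup>2"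
    using bern_exp_charlier[OF I p] unfolding f_def l(1) l2_def by auto
  then have "2 * s\<^sup>2 * bern_exp I p (\<lambda>k. (f k)\<^sup>2) \<le> 2 * s\<^sup>2 * (6 * l\<^sup>2)"
    by (intro mult_left_mono) auto
  ultimately have "2 * s * l2 - 16 * s\<^sup>2 * l\<^sup>2 \<le> D"
    using \<open>bern_exp I p f = - l2\<close> by (simp add: algebra_simps)
  moreover have "2 * s * l2 - 16 * s\<^sup>2 * l\<^sup>2 = (l2 / l)\<^sup>2 / 16"
    using l(2) by (simp add: s_def power2_eq_square field_simps)
  ultimately show ?thesis by (simp add: D_def l2_def w_def v_def)
qed

section \<open>Lower bounds from a concentration interval\<close>

lemma card_nat_interval_le:
  assumes "0 \<le> m"
  shows "finite {k::nat. \<bar>real k - l\<bar> < m}" "real (card {k::nat. \<bar>real k - l\<bar> < m}) \<le> 2 * m + 1"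
proof -
  let ?A = "{k::nat. \<bar>real k - l\<bar> < m}"
  have "?A \<subseteq> {..nat \<lceil>l + m\<rceil>}" by (auto simp: abs_less_iff) linarith
  then show fin: "finite ?A" by (rule finite_subset) simp
  show "real (card ?A) \<le> 2 * m + 1"
  proof (cases "?A = {}")
    case False
    have mm: "Min ?A \<in> ?A" "Max ?A \<in> ?A" using fin False by (rule Min_in, rule Max_in)
    have le: "Min ?A \<le> Max ?A" by (rule Max_ge[OF fin mm(1)])
    have "?A \<subseteq> {Min ?A..Max ?A}" using fin by auto
    then have "card ?A \<le> card {Min ?A..Max ?A}" by (intro card_mono) auto
    then have "real (card ?A) \<le> real (Max ?A) - real (Min ?A) + 1" using le by simp
    then show ?thesis using mm by auto
  qed (use assms in simp)
qed

text \<open>\<open>A\<close> is an interval around the mean, with length of the order of the standard deviation.\<close>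

lemma concentration_interval:
  assumes I: "finite I" and p: "\<forall>j\<in>I. 0 \<le> p j \<and> p j \<le> 1"
    and l: "l = sum p I" "0 < l" and s: "s = (\<Sum>j\<in>I. p j * (1 - p j))"
    and F: "F = max 1 l / max 1 s"
  obtains A where "A \<subseteq> {..card I}" "3 / 4 \<le> (\<Sum>k\<in>A. bern_weight I p k)"
    "(\<Sum>k\<in>A. pois l k) * sqrt F \<le> 15"
proof
  define m where "m = sqrt (max 1 s)"
  \<comment> \<open>With half-width \<open>2 * m\<close>, Chebyshev leaves mass at most 1/4
    outside.\<close>
  define A where "A = {k \<in> {..card I}. \<bar>real k - l\<bar> < 2 * m}"
  have m: "1 \<le> m" "s \<le> m\<^sup>2" by (auto simp: m_def)
  show A: "A \<subseteq> {..card I}" by (auto simp: A_def)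
  have finA: "finite A" by (simp add: A_def)
  have w: "0 \<le> bern_weight I p k" for k using I p by (rule bern_weight_nonneg)
  have "(\<Sum>k\<in>{..card I} - A. bern_weight I p k) \<le>
      (\<Sum>k\<in>{..card I} - A. bern_weight I p k * ((real k - l)\<^sup>2 / (2 * m)\<^sup>2))"
  proof (rule sum_mono)
    fix k assume "k \<in> {..card I} - A"
    then have "2 * m \<le> \<bar>real k - l\<bar>" by (auto simp: A_def)
    then have "(2 * m)\<^sup>2 \<le> (real k - l)\<^sup>2" using m power_mono[of "2 * m" "\<bar>real k - l\<bar>" 2] by simp
    then have "1 \<le> (real k - l)\<^sup>2 / (2 * m)\<^sup>2" using m by simp
    then show "bern_weight I p k \<le> bern_weight I p k * ((real k - l)\<^sup>2 / (2 * m)\<^sup>2)"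
      using w[of k] mult_left_mono by fastforce
  qed
  also have "\<dots> \<le> (\<Sum>k\<le>card I. bern_weight I p k * ((real k - l)\<^sup>2 / (2 * m)\<^sup>2))"
    using w by (intro sum_mono2) auto
  also have "\<dots> = bern_exp I p (\<lambda>k. (real k - l)\<^sup>2) / (2 * m)\<^sup>2"
    by (simp add: bern_exp_def sum_divide_distrib)
  also have "\<dots> = s / (2 * m)\<^sup>2"
    using bern_central_moments[OF I, of p] by (simp add: l s)
  also have "\<dots> \<le> 1 / 4" using m by (simp add: field_simps)
  finally have "(\<Sum>k\<in>{..card I} - A. bern_weight I p k) \<le> 1 / 4" .
  moreover have "(\<Sum>k\<in>{..card I} - A. bern_weight I p k) = 1 - (\<Sum>k\<in>A. bern_weight I p k)"
    using A I by (simp add: sum_diff sum_bern_weight)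
  ultimately show "3 / 4 \<le> (\<Sum>k\<in>A. bern_weight I p k)" by simp
  have v: "0 \<le> pois l k" for k using l by (simp add: pois_def)
  show "(\<Sum>k\<in>A. pois l k) * sqrt F \<le> 15"
  proof (cases "l \<le> 1")
    case True
    have "s \<le> l" unfolding s l using p by (intro sum_mono) (auto simp: mult_left_le)
    then have "F = 1" using True by (simp add: F max_def)
    moreover have "(\<Sum>k\<in>A. pois l k) \<le> suminf (pois l)"
      using pois_sums[of l] v finA by (intro sum_le_suminf) (auto intro: sums_summable)
    ultimately show ?thesis using sums_unique[OF pois_sums, of l] by simp
  next
    case False
    \<comment> \<open>At most 5 m points with Poisson weight at most 3 / sqrt \<lambda> each, while
      sqrt F = sqrt \<lambda> / m.\<close>
    have "real (card A) \<le> real (card {k::nat. \<bar>real k - l\<bar> < 2 * m})"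
      using card_nat_interval_le(1)[of "2 * m" l] m by (intro of_nat_mono card_mono) (auto simp: A_def)
    also have "\<dots> \<le> 5 * m" using card_nat_interval_le(2)[of "2 * m" l] m by simp
    finally have card: "real (card A) \<le> 5 * m" .
    have "(\<Sum>k\<in>A. pois l k) \<le> (\<Sum>k\<in>A. 3 / sqrt l)"
    proof (rule sum_mono)
      fix k
      have "pois l k \<le> exp 1 / sqrt l" using l by (intro pois_le_inverse_sqrt)
      also have "\<dots> \<le> 3 / sqrt l" using exp_le l by (intro divide_right_mono) auto
      finally show "pois l k \<le> 3 / sqrt l" .
    qed
    also have "\<dots> = real (card A) * (3 / sqrt l)" by simp
    also have "\<dots> \<le> 5 * m * (3 / sqrt l)" using card l by (intro mult_right_mono) auto
    finally have "(\<Sum>k\<in>A. pois l k) * sqrt F \<le> 5 * m * (3 / sqrt l) * sqrt F"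
      by (intro mult_right_mono) (auto simp: F)
    also have "\<dots> = 15"
    proof -
      have "sqrt F = sqrt l / m" using False by (simp add: F m_def real_sqrt_divide)
      then show ?thesis using l(2) m by simp
    qed
    finally show ?thesis .
  qed
qed

lemma rel_entropy_chi_square_ge_F:
  assumes I: "finite I" and p: "\<forall>j\<in>I. 0 \<le> p j \<and> p j \<le> 1"
    and l: "l = sum p I" "0 < l" and s: "s = (\<Sum>j\<in>I. p j * (1 - p j))"
    and F: "F = max 1 l / max 1 s"
  shows "3 / 8 * ln F - 15 \<le> (\<Sum>k\<le>card I. bern_weight I p k * ln (bern_weight I p k / pois l k))"
    and "sqrt F / 30 - 1 \<le> (\<Sum>k\<le>card I. (bern_weight I p k)\<^sup>2 / pois l k) - 1"
proof -
  obtain A where A: "A \<subseteq> {..card I}" and P: "3 / 4 \<le> (\<Sum>k\<in>A. bern_weight I p k)"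
    and Q: "(\<Sum>k\<in>A. pois l k) * sqrt F \<le> 15"
    using concentration_interval[OF assms] by blast
  have finA: "finite A" using A by (rule finite_subset) simp
  define w where "w = bern_weight I p"
  define v where "v = pois l"
  have w: "0 \<le> w k" for k unfolding w_def using I p by (rule bern_weight_nonneg)
  have v: "0 < v k" for k using l by (simp add: v_def pois_pos)
  have "s \<le> l" unfolding s l using p by (intro sum_mono) (auto simp: mult_left_le)
  then have F1: "1 \<le> F" by (auto simp: F max_def)
  define T where "T = sqrt F"
  have T: "1 \<le> T" "ln T = ln F / 2" "T\<^sup>2 = F" using F1 by (auto simp: T_def ln_sqrt)
  have v1: "(\<Sum>k\<le>card I. v k) \<le> 1"
    using pois_tail(1)[OF l(2), of "card I"] by (simp add: v_def)
  \<comment> \<open>Tangent bounds with t = \<open>T\<close> on \<open>A\<close> and t = 1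
    elsewhere. On \<open>A\<close> an extra \<open>v k\<close> is given away, so that the terms
    \<open>w k - v k\<close> run over the whole range and have nonnegative total.\<close>
  have "(\<Sum>k\<le>card I. w k + (if k \<in> A then w k * ln T - T * v k else 0) - v k) \<le>
      (\<Sum>k\<le>card I. w k * ln (w k / v k))"
  proof (rule sum_mono)
    fix k
    show "w k + (if k \<in> A then w k * ln T - T * v k else 0) - v k \<le> w k * ln (w k / v k)"
    proof (cases "k \<in> A")
      case True
      have "w k * ln T + w k - T * v k \<le> w k * ln (w k / v k)"
        using T by (intro rel_entropy_term_ge[OF w v]) simp
      then show ?thesis using True v[of k] by simp
    next
      case False
      then show ?thesis using rel_entropy_term_ge[OF w v, of 1 k k] by simp
    qed
  qed
  also have "(\<Sum>k\<le>card I. w k + (if k \<in> A then w k * ln T - T * v k else 0) - v k) =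
      1 + ((\<Sum>k\<in>A. w k) * ln T - T * (\<Sum>k\<in>A. v k)) - (\<Sum>k\<le>card I. v k)"
  proof -
    have "(\<Sum>k\<le>card I. if k \<in> A then w k * ln T - T * v k else 0) = (\<Sum>k\<in>A. w k * ln T - T * v k)"
      using A by (intro sum.mono_neutral_cong_right) auto
    then show ?thesis
      using I by (simp add: sum.distrib sum_subtractf sum_distrib_left sum_distrib_right w_def sum_bern_weight)
  qed
  finally have "(\<Sum>k\<in>A. w k) * ln T - T * (\<Sum>k\<in>A. v k) \<le> (\<Sum>k\<le>card I. w k * ln (w k / v k))"
    using v1 by linarith
  moreover have "3 / 4 * ln T \<le> (\<Sum>k\<in>A. w k) * ln T"
    using P T by (intro mult_right_mono) (auto simp: w_def)
  moreover have "T * (\<Sum>k\<in>A. v k) \<le> 15" using Q by (simp add: T_def v_def mult.commute)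
  ultimately show "3 / 8 * ln F - 15 \<le>
      (\<Sum>k\<le>card I. bern_weight I p k * ln (bern_weight I p k / pois l k))"
    using T by (simp add: w_def v_def)
  \<comment> \<open>The tangent bound w^2 / v >= 2 c w - c^2 v with c = T / 30, which yields T/20 -
    T/60 = T/30.\<close>
  have "(\<Sum>k\<in>A. (T / 15) * w k - (T / 30)\<^sup>2 * v k) \<le> (\<Sum>k\<in>A. (w k)\<^sup>2 / v k)"
  proof (rule sum_mono)
    fix k
    have "0 \<le> (w k - T / 30 * v k)\<^sup>2 / v k" using v[of k] by simp
    also have "\<dots> = (w k)\<^sup>2 / v k - (T / 15) * w k + (T / 30)\<^sup>2 * v k"
      using v[of k] by (simp add: power2_eq_square field_simps)
    finally show "(T / 15) * w k - (T / 30)\<^sup>2 * v k \<le> (w k)\<^sup>2 / v k" by simp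
  qed
  also have "\<dots> \<le> (\<Sum>k\<le>card I. (w k)\<^sup>2 / v k)"
    using A v by (intro sum_mono2) (auto simp: less_imp_le)
  also have "(\<Sum>k\<in>A. (T / 15) * w k - (T / 30)\<^sup>2 * v k) =
      (T / 15) * (\<Sum>k\<in>A. w k) - (T / 900) * (T * (\<Sum>k\<in>A. v k))"
    by (simp add: sum_subtractf sum_distrib_left sum_divide_distrib power2_eq_square mult.assoc)
  finally have "(T / 15) * (\<Sum>k\<in>A. w k) - (T / 900) * (T * (\<Sum>k\<in>A. v k)) \<le>
      (\<Sum>k\<le>card I. (w k)\<^sup>2 / v k)" .
  moreover have "(T / 15) * (3 / 4) \<le> (T / 15) * (\<Sum>k\<in>A. w k)"
    using P T by (intro mult_left_mono) (auto simp: w_def)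
  moreover have "(T / 900) * (T * (\<Sum>k\<in>A. v k)) \<le> (T / 900) * 15"
    using \<open>T * (\<Sum>k\<in>A. v k) \<le> 15\<close> T by (intro mult_left_mono) auto
  ultimately show "sqrt F / 30 - 1 \<le> (\<Sum>k\<le>card I. (bern_weight I p k)\<^sup>2 / pois l k) - 1"
    by (simp add: T_def w_def v_def)
qed

text \<open>Jensen's inequality for the logarithm, via its tangent at \<open>t\<close> = 1 +
  \<chi>^2; the remainder \<open>t / t - 1\<close> vanishes.\<close>

lemma rel_entropy_le_ln_chi_square:
  assumes I: "finite I" and p: "\<forall>j\<in>I. 0 \<le> p j \<and> p j \<le> 1" and l: "0 < l"
  shows "1 \<le> (\<Sum>k\<le>card I. (bern_weight I p k)\<^sup>2 / pois l k)"
    and "(\<Sum>k\<le>card I. bern_weight I p k * ln (bern_weight I p k / pois l k)) \<le>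
      ln (\<Sum>k\<le>card I. (bern_weight I p k)\<^sup>2 / pois l k)"
proof -
  define t where "t = (\<Sum>k\<le>card I. (bern_weight I p k)\<^sup>2 / pois l k)"
  have "0 \<le> t - 1"
    unfolding t_def
    by (rule sums_le[OF _ sums_zero chi_square_sums[OF I l, of p]])
      (simp add: pois_pos[OF l] less_imp_le)
  then show t: "1 \<le> (\<Sum>k\<le>card I. (bern_weight I p k)\<^sup>2 / pois l k)" by (simp add: t_def)
  then have t0: "0 < t" by (simp add: t_def)
  have "(\<Sum>k\<le>card I. bern_weight I p k * ln (bern_weight I p k / pois l k)) \<le>
      (\<Sum>k\<le>card I. bern_weight I p k * ln t + ((bern_weight I p k)\<^sup>2 / pois l k) / t - bern_weight I p k)"
    using I p l t0 by (intro sum_mono rel_entropy_term_le bern_weight_nonneg pois_pos)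
  also have "\<dots> = 1 * ln t + t / t - 1"
  proof -
    have "(\<Sum>k\<le>N. a k * c + b k / d - a k) = (\<Sum>k\<le>N. a k) * c + (\<Sum>k\<le>N. b k) / d - (\<Sum>k\<le>N. a k)"
      for a b :: "nat \<Rightarrow> real" and c d N
      by (simp add: sum.distrib sum_subtractf sum_distrib_right sum_divide_distrib)
    then show ?thesis
      using sum_bern_weight[OF I order_refl, of p] by (simp only: t_def)
  qed
  also have "\<dots> = ln t" using t0 by simp
  finally show "(\<Sum>k\<le>card I. bern_weight I p k * ln (bern_weight I p k / pois l k)) \<le>
      ln (\<Sum>k\<le>card I. (bern_weight I p k)\<^sup>2 / pois l k)" by (simp add: t_def)
qed

section \<open>Assembly of the four inequalities\<close>

theorem theorem1p1:
  shows "\<exists>c\<^sub>1 c\<^sub>2 :: real. c\<^sub>1 > 0 \<and> c\<^sub>2 > 0 \<and>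
    (\<forall>(n::nat) (p :: nat \<Rightarrow> real). n \<ge> 1 \<longrightarrow> (\<forall>j\<in>{1..n}. 0 \<le> p j \<and> p j \<le> 1) \<longrightarrow>
      (\<Sum>j=1..n. p j) > 0 \<longrightarrow>
      (let lam = (\<Sum>j=1..n. p j);
           lam2 = (\<Sum>j=1..n. (p j)\<^sup>2);
           F = max 1 lam / max 1 (lam - lam2);
           W = bernoulli_sum_pmf n p;
           Z = poisson_pmf lam
       in c\<^sub>1 * (lam2 / lam)\<^sup>2 * (1 + ln F) \<le> rel_entropy W Z \<and>
          rel_entropy W Z \<le> c\<^sub>2 * (lam2 / lam)\<^sup>2 * (1 + ln F) \<and>
          c\<^sub>1 * (lam2 / lam)\<^sup>2 * sqrt F \<le> chi_square_dist W Z \<and>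
          chi_square_dist W Z \<le> c\<^sub>2 * (lam2 / lam)\<^sup>2 * sqrt F))"
proof (rule exI[of _ "1 / 1000"], rule exI[of _ 2304], intro conjI allI impI)
  fix n :: nat and p :: "nat \<Rightarrow> real"
  assume p: "\<forall>j\<in>{1..n}. 0 \<le> p j \<and> p j \<le> 1" and pos: "(\<Sum>j=1..n. p j) > 0"
  define I where "I = {1..n}"
  have I: "finite I" "\<forall>j\<in>I. 0 \<le> p j \<and> p j \<le> 1" "card I = n" using p by (auto simp: I_def)
  define lam where "lam = sum p I"
  define lam2 where "lam2 = (\<Sum>j\<in>I. (p j)\<^sup>2)"
  define s where "s = (\<Sum>j\<in>I. p j * (1 - p j))"
  define F where "F = max 1 lam / max 1 s"
  define W where "W = bernoulli_sum_pmf n p"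
  define Z where "Z = poisson_pmf lam"
  define D where "D = (\<Sum>k\<le>card I. bern_weight I p k * ln (bern_weight I p k / pois lam k))"
  define chi where "chi = (\<Sum>k\<le>card I. (bern_weight I p k)\<^sup>2 / pois lam k) - 1"
  define th where "th = (lam2 / lam)\<^sup>2"
  have lam: "0 < lam" using pos by (simp add: lam_def I_def)
  have s_eq: "s = lam - lam2"
    by (simp add: s_def lam_def lam2_def sum_subtractf [symmetric] power2_eq_square algebra_simps)
  have W: "pmf W k = bern_weight I p k" for k
    unfolding W_def bernoulli_sum_pmf_def I_def [symmetric] using I by (intro pmf_sum_Pi_bernoulli)
  have Z: "pmf Z k = pois lam k" for k using lam by (simp add: Z_def pois_def)
  have "(\<lambda>k. pmf W k * ln (pmf W k / pmf Z k)) sums D"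
    unfolding W Z D_def using I by (intro sums_finite) (auto simp: bern_weight_eq_0)
  then have D: "rel_entropy W Z = D" unfolding rel_entropy_def by (rule sums_unique [symmetric])
  have "(\<lambda>k. (pmf W k - pmf Z k)\<^sup>2 / pmf Z k) sums chi"
    unfolding W Z chi_def using I lam by (intro chi_square_sums)
  then have chi: "chi_square_dist W Z = chi" unfolding chi_square_dist_def by (rule sums_unique [symmetric])
  have s0: "0 \<le> s" unfolding s_def using I by (intro sum_nonneg) auto
  have "0 \<le> lam2" unfolding lam2_def by (intro sum_nonneg) auto
  then have q: "0 \<le> lam2 / lam" "lam2 / lam \<le> 1" using s0 s_eq lam by auto
  then have th: "0 \<le> th" "th \<le> 1" by (auto simp: th_def power_le_one)
  have "s \<le> lam" using \<open>0 \<le> lam2\<close> s_eq by simp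
  then have F: "1 \<le> F" by (auto simp: F_def max_def)
  then have lnF: "0 \<le> ln F" and sqF: "1 \<le> sqrt F" by auto
  have D1: "th / 16 \<le> D"
    unfolding th_def lam2_def D_def using I lam by (intro rel_entropy_ge_theta) (auto simp: lam_def)
  have D2: "3 / 8 * ln F - 15 \<le> D" and chi2: "sqrt F / 30 - 1 \<le> chi"
    using rel_entropy_chi_square_ge_F[OF I(1,2) lam_def lam s_def F_def] by (simp_all add: D_def chi_def)
  have Dln: "D \<le> ln (1 + chi)" and chi0: "0 \<le> chi"
    using rel_entropy_le_ln_chi_square[OF I(1,2) lam] by (simp_all add: D_def chi_def)
  have Dchi: "D \<le> chi" using Dln ln_add_one_self_le_self[OF chi0] by linarith
  have chiU: "chi \<le> th * (576 * sqrt F)"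
    unfolding chi_def th_def lam2_def F_def using I lam
    by (intro chi_square_le) (auto simp: lam_def s_def)
  \<comment> \<open>For ln F <= 60 the bound \<open>th / 16\<close> suffices since 61/1000 < 1/16;
    beyond that \<open>3 / 8 * ln F - 15\<close> wins because \<open>th\<close> <= 1.\<close>
  have a: "1 / 1000 * th * (1 + ln F) \<le> D"
  proof (cases "ln F \<le> 60")
    case True
    have "1 / 1000 * th * (1 + ln F) \<le> 1 / 1000 * th * 61" using th True by (intro mult_left_mono) auto
    then show ?thesis using D1 th by linarith
  next
    case False
    have "1 / 1000 * th * (1 + ln F) \<le> 1 / 1000 * 1 * (1 + ln F)"
      using th lnF by (intro mult_right_mono mult_left_mono) auto
    also have "\<dots> \<le> D" using D2 False by simp
    finally show ?thesis .
  qed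
  \<comment> \<open>If \<lambda>_2 / \<lambda> <= 1/2 then F is bounded and D <= \<chi>^2 is enough.
    Otherwise \<open>th\<close> >= 1/4, and ln(1 + \<chi>^2) is of order 1 + ln F; this gives 2304 =
    4 * 576.\<close>
  have b: "D \<le> 2304 * th * (1 + ln F)"
  proof (cases "lam2 / lam \<le> 1 / 2")
    case True
    then have "lam \<le> 2 * s" using lam s_eq by (simp add: field_simps)
    then have "max 1 lam \<le> 2 * max 1 s" by (auto simp: max_def)
    then have "F \<le> 2\<^sup>2" unfolding F_def by (auto simp: field_simps max_def)
    then have "sqrt F \<le> 2" by (intro real_le_lsqrt) auto
    then have "th * (576 * sqrt F) \<le> th * (576 * 2)" using th by (intro mult_left_mono) auto
    then have "D \<le> th * 2304" using Dchi chiU th by linarith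
    also have "\<dots> \<le> th * 2304 * (1 + ln F)"
      using mult_left_mono[of 1 "1 + ln F" "th * 2304"] lnF th by simp
    finally show ?thesis by (simp add: mult_ac)
  next
    case False
    then have "(1 / 2)\<^sup>2 \<le> th" unfolding th_def by (intro power_mono) auto
    then have th4: "1 \<le> 4 * th" by (simp add: power2_eq_square)
    have "th * (576 * sqrt F) \<le> 1 * (576 * sqrt F)" using th F by (intro mult_right_mono) auto
    then have "1 + chi \<le> 577 * sqrt F" using chiU sqF by linarith
    then have "ln (1 + chi) \<le> ln (577 * sqrt F)" using chi0 by (intro ln_mono) auto
    also have "\<dots> = ln 577 + ln F / 2" using F by (simp add: ln_mult ln_sqrt)
    also have "\<dots> \<le> 576 * (1 + ln F)" using ln_le_minus_one[of 577] lnF by simp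
    also have "\<dots> \<le> 576 * (1 + ln F) * (4 * th)"
      using mult_left_mono[OF th4, of "576 * (1 + ln F)"] lnF by simp
    finally show ?thesis using Dln by (simp add: mult_ac)
  qed
  \<comment> \<open>For sqrt F <= 60 the entropy bound transfers through D <= \<chi>^2; for larger F
    the interval bound applies.\<close>
  have c: "1 / 1000 * th * sqrt F \<le> chi"
  proof (cases "sqrt F \<le> 60")
    case True
    have "1 / 1000 * th * sqrt F \<le> 1 / 1000 * th * 60" using th True by (intro mult_left_mono) auto
    then show ?thesis using D1 Dchi th by linarith
  next
    case False
    have "1 / 1000 * th * sqrt F \<le> 1 / 1000 * 1 * sqrt F"
      using th F by (intro mult_right_mono mult_left_mono) auto
    also have "\<dots> \<le> chi" using chi2 False by simp
    finally show ?thesis .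
  qed
  have d: "chi \<le> 2304 * th * sqrt F"
  proof -
    have "0 \<le> th * sqrt F" using th F by simp
    then show ?thesis using chiU by simp
  qed
  show "let lam = (\<Sum>j=1..n. p j);
           lam2 = (\<Sum>j=1..n. (p j)\<^sup>2);
           F = max 1 lam / max 1 (lam - lam2);
           W = bernoulli_sum_pmf n p;
           Z = poisson_pmf lam
       in 1 / 1000 * (lam2 / lam)\<^sup>2 * (1 + ln F) \<le> rel_entropy W Z \<and>
          rel_entropy W Z \<le> 2304 * (lam2 / lam)\<^sup>2 * (1 + ln F) \<and>
          1 / 1000 * (lam2 / lam)\<^sup>2 * sqrt F \<le> chi_square_dist W Z \<and>
          chi_square_dist W Z \<le> 2304 * (lam2 / lam)\<^sup>2 * sqrt F"
    using a b c d unfolding Let_def I_def [symmetric] lam_def [symmetric] lam2_def [symmetric]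
      s_eq [symmetric] F_def [symmetric] W_def [symmetric] Z_def [symmetric] D chi th_def [symmetric]
    by simp
qed simp_all

end
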